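(* Let $G$ be a finite group and let $[\alpha]\in H^2(G,\mathbb{C}^* )$ be non-degenerate, so that $\mathbb{C}^{\alpha}G$ is a simple complex algebra. Let $N\lhd G$. The quotient $[(\mathbb{C}^{\alpha}G)/N]$ of the twisted group algebra grading class $[\mathbb{C}^{\alpha}G]$ is an elementary crossed product grading class if and only if the normal subgroup $N\lhd G$ is an abelian Lagrangian with respect to $[\alpha]$.
   Context: A $\Gamma$-grading of a complex algebra $\mathcal{A}$ is a decomposition $\mathcal{A}=\bigoplus_{\gamma\in\Gamma}\mathcal{A}_\gamma$ with $\mathcal{A}_{\gamma_1}\mathcal{A}_{\gamma_2}\subseteq\mathcal{A}_{\gamma_1\gamma_2}$. A $\Gamma_1$-grading of $\mathcal{A}$ and a $\Gamma_2$-grading of $\mathcal{B}$ are graded-equivalent if there are an algebra isomorphism $\psi:\mathcal{A}\to\mathcal{B}$ and a group isomorphism $\phi:\Gamma_1\to\Gamma_2$ with $\psi(\mathcal{A}_\gamma)\subseteq\mathcal{B}_{\phi(\gamma)}$ for all $\gamma$; $[\cdot]$ denotes the graded-equivalence class. For $\alpha\in Z^2(G,\mathbb{C}^* )$ (trivial action), $\mathbb{C}^{\alpha}G=\bigoplus_{g\in G}\mathbb{C}u_g$, $u_gu_h=\alpha(g,h)u_{gh}$, is graded by $G$ via $(\mathbb{C}^{\alpha}G)_g=\mathbb{C}u_g$. The quotient grading $(\mathbb{C}^{\alpha}G)/N$ is the $G/N$-grading of $\mathbb{C}^{\alpha}G$ with homogeneous components $\bigoplus_{g\in\bar g}\mathbb{C}u_g$,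 $\bar g\in G/N$. The class $[\alpha]$ is non-degenerate if $\mathbb{C}^{\alpha}G$ is simple (isomorphic to some $M_n(\mathbb{C})$). For a group $\Gamma$ and $x=\sum_{i=1}^r\gamma_i\in\mathbb{N}[\Gamma]$, $x(\mathbb{C})$ denotes the elementary $\Gamma$-grading of $M_r(\mathbb{C})$ in which the matrix unit $E_{i,j}$ has degree $\gamma_i\gamma_j^{-1}$. For a finite group $\Gamma$ of order $n$, the elementary crossed product $\Gamma$-grading of $M_n(\mathbb{C})$ is $\left(\sum_{\gamma\in\Gamma}\gamma\right)(\mathbb{C})$. A subgroup $H<G$ is $[\alpha]$-isotropic if the restriction of $[\alpha]$ to $H$ is trivial. If moreover $[\alpha]$ is non-degenerate and $|H|^2=|G|$, then $H$ is a Lagrangian with respect to $[\alpha]$. *)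

theory Defs
  imports "HOL-Algebra.QuotRing" "Jordan_Normal_Form.VS_Connect"
begin

section \<open>Graded complex algebras\<close>

text \<open>
  The locale \<^locale>\<open>algebra\<close> of HOL-Algebra demands a commutative algebra, so unital
  associative complex algebras are put together from \<^locale>\<open>ring\<close> and \<^locale>\<open>module\<close>.
\<close>

definition complex_algebra :: "(complex, 'a) module \<Rightarrow> bool" where
  "complex_algebra A \<longleftrightarrow>
     ring A \<and> Module.module (class_ring :: complex ring) A \<and>
     (\<forall>c. \<forall>x\<in>carrier A. \<forall>y\<in>carrier A.
        (c \<odot>\<^bsub>A\<^esub> x) \<otimes>\<^bsub>A\<^esub> y = c \<odot>\<^bsub>A\<^esub> (x \<otimes>\<^bsub>A\<^esub> y) \<and>
        x \<otimes>\<^bsub>A\<^esub> (c \<odot>\<^bsub>A\<^esub> y) = c \<odot>\<^bsub>A\<^esub> (x \<otimes>\<^bsub>A\<^esub> y))"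

definition algebra_iso :: "(complex, 'a) module \<Rightarrow> (complex, 'b) module \<Rightarrow> ('a \<Rightarrow> 'b) set" where
  "algebra_iso A B =
     {\<psi> \<in> ring_iso A B. \<forall>c. \<forall>x\<in>carrier A. \<psi> (c \<odot>\<^bsub>A\<^esub> x) = c \<odot>\<^bsub>B\<^esub> \<psi> x}"

text \<open>
  Ring ideals of a unital algebra are automatically closed under scalars, so the two-sided
  ideals below are exactly the algebra ideals.
\<close>

definition simple_algebra :: "(complex, 'a) module \<Rightarrow> bool" where
  "simple_algebra A \<longleftrightarrow>
     complex_algebra A \<and> carrier A \<noteq> {\<zero>\<^bsub>A\<^esub>} \<and>
     (\<forall>I. ideal I A \<longrightarrow> I = {\<zero>\<^bsub>A\<^esub>} \<or> I = carrier A)"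

record ('g, 'a) graded_algebra =
  grading_group :: "'g monoid"
  alg :: "(complex, 'a) module"
  hcomp :: "'g \<Rightarrow> 'a set"

text \<open>
  Unique existence of the family \<open>f\<close> of homogeneous parts says that the algebra is the
  internal direct sum of the components; the values of \<^const>\<open>hcomp\<close> outside the
  carrier of the grading group carry no information.
\<close>

definition is_grading :: "('g, 'a) graded_algebra \<Rightarrow> bool" where
  "is_grading \<A> \<longleftrightarrow> (let \<Gamma> = grading_group \<A>; A = alg \<A>; C = hcomp \<A> in
     group \<Gamma> \<and> complex_algebra A \<and>
     (\<forall>\<gamma>\<in>carrier \<Gamma>. Module.submodule (C \<gamma>) (class_ring :: complex ring) A) \<and>
     (\<forall>a\<in>carrier A. \<exists>!f. f \<in> (\<Pi>\<^sub>E \<gamma>\<in>carrier \<Gamma>. C \<gamma>) \<and>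
        finite {\<gamma> \<in> carrier \<Gamma>. f \<gamma> \<noteq> \<zero>\<^bsub>A\<^esub>} \<and>
        a = (\<Oplus>\<^bsub>A\<^esub>\<gamma>\<in>{\<gamma> \<in> carrier \<Gamma>. f \<gamma> \<noteq> \<zero>\<^bsub>A\<^esub>}. f \<gamma>)) \<and>
     (\<forall>\<gamma>\<in>carrier \<Gamma>. \<forall>\<delta>\<in>carrier \<Gamma>. \<forall>a\<in>C \<gamma>. \<forall>b\<in>C \<delta>.
        a \<otimes>\<^bsub>A\<^esub> b \<in> C (\<gamma> \<otimes>\<^bsub>\<Gamma>\<^esub> \<delta>)))"

definition graded_equivalent ::
  "('g, 'a) graded_algebra \<Rightarrow> ('h, 'b) graded_algebra \<Rightarrow> bool" where
  "graded_equivalent \<A> \<B> \<longleftrightarrow>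
     is_grading \<A> \<and> is_grading \<B> \<and>
     (\<exists>\<psi> \<in> algebra_iso (alg \<A>) (alg \<B>).
      \<exists>\<phi> \<in> iso (grading_group \<A>) (grading_group \<B>).
        \<forall>\<gamma>\<in>carrier (grading_group \<A>). \<psi> ` hcomp \<A> \<gamma> \<subseteq> hcomp \<B> (\<phi> \<gamma>))"

text \<open>
  The component of a coset \<open>S\<close> is the sum of the components \<open>hcomp \<A> g\<close>, \<open>g \<in> S\<close>,
  written as the set of all finite sums of elements of these components.
\<close>

definition quotient_grading ::
  "('g, 'a) graded_algebra \<Rightarrow> 'g set \<Rightarrow> ('g set, 'a) graded_algebra" where
  "quotient_grading \<A> N =
     \<lparr> grading_group = grading_group \<A> Mod N,
       alg = alg \<A>,
       hcomp = (\<lambda>S. {\<Oplus>\<^bsub>alg \<A>\<^esub>g\<in>F. f g | F f. finite F \<and> F \<subseteq> S \<and> f \<in> (\<Pi> g\<in>F. hcomp \<A> g)}) \<rparr>"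

section \<open>Cocycles and twisted group algebras\<close>

text \<open>
  A cohomology class in \<open>H\<^sup>2(G, \<complex>\<^sup>*)\<close> (trivial action) is given by a representing cocycle;
  only the values on \<^term>\<open>carrier G\<close> matter and cocycles need not be normalised.
\<close>

definition two_cocycle :: "'g monoid \<Rightarrow> ('g \<Rightarrow> 'g \<Rightarrow> complex) \<Rightarrow> bool" where
  "two_cocycle G \<alpha> \<longleftrightarrow>
     (\<forall>g\<in>carrier G. \<forall>h\<in>carrier G. \<alpha> g h \<noteq> 0) \<and>
     (\<forall>g\<in>carrier G. \<forall>h\<in>carrier G. \<forall>k\<in>carrier G.
        \<alpha> g h * \<alpha> (g \<otimes>\<^bsub>G\<^esub> h) k = \<alpha> g (h \<otimes>\<^bsub>G\<^esub> k) * \<alpha> h k)"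

definition cohomologous ::
  "'g monoid \<Rightarrow> ('g \<Rightarrow> 'g \<Rightarrow> complex) \<Rightarrow> ('g \<Rightarrow> 'g \<Rightarrow> complex) \<Rightarrow> bool" where
  "cohomologous G \<alpha> \<beta> \<longleftrightarrow>
     (\<exists>l. (\<forall>g\<in>carrier G. l g \<noteq> 0) \<and>
        (\<forall>g\<in>carrier G. \<forall>h\<in>carrier G. \<alpha> g h = l g * l h / l (g \<otimes>\<^bsub>G\<^esub> h) * \<beta> g h))"

text \<open>
  For finite \<open>G\<close>, the element \<open>\<Sum>g. f g \<cdot> u_g\<close> is represented by its coefficient function
  \<open>f\<close>, extended by 0 outside \<^term>\<open>carrier G\<close>.  The product is the bilinear extension of
  \<open>u_g u_h = \<alpha>(g,h) u_gh\<close>; as \<open>u_1 u_1 = \<alpha>(1,1) u_1\<close>, the identity is \<open>\<alpha>(1,1)\<^sup>-\<^sup>1 u_1\<close>.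
\<close>

definition twisted_group_algebra ::
  "'g monoid \<Rightarrow> ('g \<Rightarrow> 'g \<Rightarrow> complex) \<Rightarrow> (complex, 'g \<Rightarrow> complex) module" where
  "twisted_group_algebra G \<alpha> =
     \<lparr> carrier = {f. \<forall>x. x \<notin> carrier G \<longrightarrow> f x = 0},
       mult = (\<lambda>f h x. \<Sum>(a, b) \<in> {(a, b) \<in> carrier G \<times> carrier G. a \<otimes>\<^bsub>G\<^esub> b = x}.
                 f a * h b * \<alpha> a b),
       one = (\<lambda>x. if x = \<one>\<^bsub>G\<^esub> then inverse (\<alpha> \<one>\<^bsub>G\<^esub> \<one>\<^bsub>G\<^esub>) else 0),
       zero = (\<lambda>x. 0),
       add = (\<lambda>f h x. f x + h x),
       smult = (\<lambda>c f x. c * f x) \<rparr>"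

definition tga_basis :: "'g \<Rightarrow> 'g \<Rightarrow> complex" where
  "tga_basis g = (\<lambda>x. if x = g then 1 else 0)"

definition twisted_grading ::
  "'g monoid \<Rightarrow> ('g \<Rightarrow> 'g \<Rightarrow> complex) \<Rightarrow> ('g, 'g \<Rightarrow> complex) graded_algebra" where
  "twisted_grading G \<alpha> =
     \<lparr> grading_group = G,
       alg = twisted_group_algebra G \<alpha>,
       hcomp = (\<lambda>g. {c \<odot>\<^bsub>twisted_group_algebra G \<alpha>\<^esub> tga_basis g | c. True}) \<rparr>"

definition nondegenerate :: "'g monoid \<Rightarrow> ('g \<Rightarrow> 'g \<Rightarrow> complex) \<Rightarrow> bool" where
  "nondegenerate G \<alpha> \<longleftrightarrow> simple_algebra (twisted_group_algebra G \<alpha>)"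

definition isotropic :: "'g monoid \<Rightarrow> ('g \<Rightarrow> 'g \<Rightarrow> complex) \<Rightarrow> 'g set \<Rightarrow> bool" where
  "isotropic G \<alpha> H \<longleftrightarrow>
     subgroup H G \<and> cohomologous (G\<lparr>carrier := H\<rparr>) \<alpha> (\<lambda>_ _. 1)"

definition lagrangian :: "'g monoid \<Rightarrow> ('g \<Rightarrow> 'g \<Rightarrow> complex) \<Rightarrow> 'g set \<Rightarrow> bool" where
  "lagrangian G \<alpha> H \<longleftrightarrow>
     isotropic G \<alpha> H \<and> nondegenerate G \<alpha> \<and> (card H)\<^sup>2 = Coset.order G"

section \<open>Elementary gradings\<close>

text \<open>
  An element \<open>\<gamma>\<^sub>1 + \<dots> + \<gamma>\<^sub>r\<close> of \<open>\<nat>[\<Gamma>]\<close> is given by a list of its summands.  The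
  component of degree \<open>\<gamma>\<close> is the span of the matrix units \<open>E\<^sub>i\<^sub>j\<close> with \<open>\<gamma>\<^sub>i \<gamma>\<^sub>j\<^sup>-\<^sup>1 = \<gamma>\<close>.
\<close>

definition elementary_grading :: "'g monoid \<Rightarrow> 'g list \<Rightarrow> ('g, complex mat) graded_algebra" where
  "elementary_grading \<Gamma> gs = (let r = length gs in
     \<lparr> grading_group = \<Gamma>,
       alg = module_mat TYPE(complex) r r,
       hcomp = (\<lambda>\<gamma>. {M \<in> carrier_mat r r. \<forall>i<r. \<forall>j<r.
                  M $$ (i, j) \<noteq> 0 \<longrightarrow> gs ! i \<otimes>\<^bsub>\<Gamma>\<^esub> inv\<^bsub>\<Gamma>\<^esub> (gs ! j) = \<gamma>}) \<rparr>)"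

text \<open>
  \<open>gs\<close> lists every element of the finite group \<open>\<Gamma>\<close> exactly once; another enumeration
  only permutes the matrix units.  Letting \<open>\<Gamma>\<close> live on the type of the group grading
  \<open>\<A>\<close> is no restriction: a group isomorphic to \<^term>\<open>grading_group \<A>\<close> can be
  replaced by \<^term>\<open>grading_group \<A>\<close> itself.
\<close>

definition elementary_crossed_product_class :: "('g, 'a) graded_algebra \<Rightarrow> bool" where
  "elementary_crossed_product_class \<A> \<longleftrightarrow>
     (\<exists>(\<Gamma> :: 'g monoid) gs. group \<Gamma> \<and> distinct gs \<and> set gs = carrier \<Gamma> \<and>
        graded_equivalent \<A> (elementary_grading \<Gamma> gs))"

end

theory Submission
  imports Defs "HOL-Library.Function_Algebras"
begin

text \<open>
  If the quotient grading is an elementary crossed product, comparing dimensions gives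
  \<open>|G| = |G/N|\<^sup>2\<close>, hence \<open>|N|\<^sup>2 = |G|\<close>.  The component of degree 1, the span of the \<open>u_n\<close>
  with \<open>n \<in> N\<close>, is mapped to diagonal matrices; so the \<open>u_n\<close> commute and \<open>N\<close> is abelian, and
  reading off one diagonal entry of \<open>u_n\<close> trivialises \<open>\<alpha>\<close> on \<open>N\<close>.

  Conversely, if \<open>\<alpha>\<close> is trivial on \<open>N\<close>, the corresponding one-dimensional module of the twisted
  group algebra of \<open>N\<close> induces a module with basis indexed by \<open>G/N\<close>, on which \<open>u_g\<close> acts by a
  monomial matrix over the translation by \<open>gN\<close>.  The resulting graded homomorphism to matrices
  of size \<open>|G/N|\<close> is injective by simplicity and surjective because \<open>|G/N|\<^sup>2 = |G|\<close>.
\<close>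

section \<open>Algebras with coordinates\<close>

text \<open>Lets coordinates be computed with ordinary sums instead of \<open>finsum\<close>. On an
  infinite index set both sums default to a zero, and additivity forces \<open>F\<close> to send
  zero to zero.\<close>

lemma (in abelian_monoid) additive_finsum:
  fixes F :: "'a \<Rightarrow> 'c :: ab_group_add"
  assumes "\<And>a b. a \<in> carrier G \<Longrightarrow> b \<in> carrier G \<Longrightarrow> F (a \<oplus> b) = F a + F b"
    and "f \<in> S \<rightarrow> carrier G"
  shows "F (finsum G f S) = (\<Sum>s\<in>S. F (f s))"
proof -
  have F0: "F \<zero> = 0"
    using assms(1)[of \<zero> \<zero>] by simp
  show ?thesis
    using assms(2)
  proof (induction S rule: infinite_finite_induct)
    case (infinite S)
    then show ?case by (simp add: F0 finsum_infinite)
  next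
    case empty
    then show ?case by (simp add: F0)
  next
    case (insert s S)
    then have "finsum G f (insert s S) = f s \<oplus> finsum G f S"
      by (intro finsum_insert) auto
    moreover have "finsum G f S \<in> carrier G" "f s \<in> carrier G"
      using insert by auto
    ultimately show ?case
      using insert by (simp add: assms(1) Pi_def)
  qed
qed

section \<open>Dimension counting for functions with finite support\<close>

interpretation fun_space: vector_space "\<lambda>(c::complex) (f::'y \<Rightarrow> complex) x. c * f x"
  by unfold_locales (auto simp: fun_eq_iff algebra_simps)

lemma sum_fun_apply: "(\<Sum>i\<in>I. g i) x = (\<Sum>i\<in>I. g i x)"
  for g :: "'i \<Rightarrow> 'y \<Rightarrow> 'c :: comm_monoid_add"
  by (induction I rule: infinite_finite_induct) auto

text \<open>Functions vanishing off \<open>Y\<close> lie in the span of the indicator functions of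
  the points of \<open>Y\<close>, which bounds the size of every independent set. In the case of
  equality, a function outside the span of the family would enlarge it to an independent set
  exceeding that bound. Independence is stated for the indexed family, so injectivity of
  \<open>b\<close> has to be derived first.\<close>

lemma independent_functions:
  fixes b :: "'x \<Rightarrow> 'y \<Rightarrow> complex"
  assumes "finite X" "finite Y"
    and supp: "\<And>x y. x \<in> X \<Longrightarrow> y \<notin> Y \<Longrightarrow> b x y = 0"
    and indep: "\<And>c. (\<And>y. (\<Sum>x\<in>X. c x * b x y) = 0) \<Longrightarrow> \<forall>x\<in>X. c x = 0"
  shows "card X \<le> card Y"
    and "card X = card Y \<Longrightarrow> (\<And>y. y \<notin> Y \<Longrightarrow> h y = 0) \<Longrightarrow> \<exists>c. \<forall>y. h y = (\<Sum>x\<in>X. c x * b x y)"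
proof -
  let ?T = "tga_basis ` Y :: ('y \<Rightarrow> complex) set"
  have inj: "inj_on b X"
  proof (rule inj_onI, rule ccontr)
    fix x x' assume x: "x \<in> X" "x' \<in> X" "b x = b x'" "x \<noteq> x'"
    \<comment> \<open>If \<open>b x = b x'\<close>, the difference of the two indicators is a
      relation whose coefficient at \<open>x\<close> is 1.\<close>
    let ?c = "\<lambda>z. (if z = x then 1 else 0) - (if z = x' then 1 else 0) :: complex"
    have "(\<Sum>z\<in>X. ?c z * b z y) = 0" for y
    proof -
      have "(\<Sum>z\<in>X. ?c z * b z y) = (\<Sum>z\<in>X. (if z = x then b x y else 0) - (if z = x' then b x' y else 0))"
        by (intro sum.cong) auto
      also have "\<dots> = 0"
        using x \<open>finite X\<close> by (simp add: sum_subtractf)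
      finally show ?thesis .
    qed
    then have "\<forall>z\<in>X. ?c z = 0"
      by (rule indep)
    with x(1,4) show False
      by auto
  qed
  have ind: "fun_space.independent (b ` X)"
  proof (rule fun_space.independent_if_scalars_zero)
    show "finite (b ` X)" using \<open>finite X\<close> by simp
    fix f v assume "(\<Sum>v\<in>b ` X. (\<lambda>y. f v * v y)) = 0" and v: "v \<in> b ` X"
    then have "(\<Sum>x\<in>X. (\<lambda>y. f (b x) * b x y)) = 0"
      by (simp add: sum.reindex[OF inj])
    then have "(\<Sum>x\<in>X. f (b x) * b x y) = 0" for y
      by (auto dest: fun_cong[of _ _ y] simp: sum_fun_apply)
    then have "\<forall>x\<in>X. f (b x) = 0"
      by (rule indep)
    with v show "f v = 0"
      by auto
  qed
  have span: "h \<in> fun_space.span ?T" if "\<And>y. y \<notin> Y \<Longrightarrow> h y = 0" for h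
  proof -
    have "h = (\<Sum>y\<in>Y. (\<lambda>z. h y * tga_basis y z))"
    proof
      fix z
      show "h z = (\<Sum>y\<in>Y. (\<lambda>z. h y * tga_basis y z)) z"
      proof -
        have "(\<Sum>y\<in>Y. h y * tga_basis y z) = (\<Sum>y\<in>Y. if z = y then h z else 0)"
          by (intro sum.cong) (auto simp: tga_basis_def)
        then show ?thesis
          using that[of z] \<open>finite Y\<close> by (auto simp: sum_fun_apply)
      qed
    qed
    also have "\<dots> \<in> fun_space.span ?T"
      by (intro fun_space.span_sum fun_space.span_scale fun_space.span_base) auto
    finally show ?thesis .
  qed
  have cT: "card ?T \<le> card Y" "finite ?T"
    using \<open>finite Y\<close> by (auto intro: card_image_le)
  have cX: "card (b ` X) = card X"
    using inj by (rule card_image)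
  have bT: "b ` X \<subseteq> fun_space.span ?T"
    using supp span by auto
  show "card X \<le> card Y"
    using fun_space.independent_span_bound[OF cT(2) ind bT] cT cX by simp
  assume eq: "card X = card Y" and h: "\<And>y. y \<notin> Y \<Longrightarrow> h y = 0"
  have "h \<in> fun_space.span (b ` X)"
  proof (rule ccontr)
    assume n: "h \<notin> fun_space.span (b ` X)"
    then have "h \<notin> b ` X"
      using fun_space.span_base[of h "b ` X"] by metis
    have "fun_space.independent (insert h (b ` X))"
      using n ind by (rule fun_space.independent_insertI)
    moreover have "insert h (b ` X) \<subseteq> fun_space.span ?T"
      using bT span[of h] h by simp
    ultimately have "card (insert h (b ` X)) \<le> card ?T"
      using fun_space.independent_span_bound[OF cT(2)] by metis
    moreover have "card (insert h (b ` X)) = Suc (card X)"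
      using \<open>h \<notin> b ` X\<close> \<open>finite X\<close> cX by simp
    ultimately show False
      using cT eq by simp
  qed
  then obtain u where "h = (\<Sum>v\<in>b ` X. (\<lambda>y. u v * v y))"
    unfolding fun_space.span_finite[OF finite_imageI[OF \<open>finite X\<close>]] by (rule imageE)
  then have "h y = (\<Sum>x\<in>X. u (b x) * b x y)" for y
    by (simp add: sum.reindex[OF inj] sum_fun_apply)
  then show "\<exists>c. \<forall>y. h y = (\<Sum>x\<in>X. c x * b x y)"
    by (intro exI[of _ "\<lambda>x. u (b x)"]) simp
qed

text \<open>By \<open>ev_ext\<close> and \<open>ev_surj\<close> the coordinate map is a linear
  bijection onto the functions on the finite set \<open>X\<close>, so \<open>card X\<close> is the
  dimension. Twisted group algebras (\<open>X = carrier G\<close>) and matrix algebras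
  (\<open>X\<close> the set of index pairs) are both instances, so one argument about gradings and
  dimensions serves both.\<close>

locale coordinates = Module.module "class_ring :: complex ring" A
  for A :: "(complex, 'a) module" +
  fixes X :: "'x set" and ev :: "'x \<Rightarrow> 'a \<Rightarrow> complex"
  assumes finite_X: "finite X"
    and ev_add: "\<lbrakk>x \<in> X; a \<in> carrier A; b \<in> carrier A\<rbrakk> \<Longrightarrow> ev x (a \<oplus>\<^bsub>A\<^esub> b) = ev x a + ev x b"
    and ev_smult: "\<lbrakk>x \<in> X; a \<in> carrier A\<rbrakk> \<Longrightarrow> ev x (c \<odot>\<^bsub>A\<^esub> a) = c * ev x a"
    and ev_ext: "\<lbrakk>a \<in> carrier A; b \<in> carrier A; \<And>x. x \<in> X \<Longrightarrow> ev x a = ev x b\<rbrakk> \<Longrightarrow> a = b"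
    and ev_surj: "\<exists>a\<in>carrier A. \<forall>x\<in>X. ev x a = h x"
begin

lemma smult_mem: "a \<in> carrier A \<Longrightarrow> c \<odot>\<^bsub>A\<^esub> a \<in> carrier A"
  by (rule smult_closed) (simp add: class_ring_simps)

lemma ev_zero: "x \<in> X \<Longrightarrow> ev x \<zero>\<^bsub>A\<^esub> = 0"
  using ev_add[of x "\<zero>\<^bsub>A\<^esub>" "\<zero>\<^bsub>A\<^esub>"] by simp

lemma ev_finsum:
  "\<lbrakk>x \<in> X; f \<in> S \<rightarrow> carrier A\<rbrakk> \<Longrightarrow> ev x (finsum A f S) = (\<Sum>s\<in>S. ev x (f s))"
  by (rule M.additive_finsum) (auto simp: ev_add)

lemma ev_minus: "\<lbrakk>x \<in> X; a \<in> carrier A\<rbrakk> \<Longrightarrow> ev x (\<ominus>\<^bsub>A\<^esub> a) = - ev x a"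
  using ev_add[of x a "\<ominus>\<^bsub>A\<^esub> a"] by (simp add: M.r_neg ev_zero eq_neg_iff_add_eq_0 add.commute)

definition from_coords :: "('x \<Rightarrow> complex) \<Rightarrow> 'a" where
  "from_coords h = (SOME a. a \<in> carrier A \<and> (\<forall>x\<in>X. ev x a = h x))"

lemma from_coords: "from_coords h \<in> carrier A" "x \<in> X \<Longrightarrow> ev x (from_coords h) = h x"
proof -
  have "from_coords h \<in> carrier A \<and> (\<forall>x\<in>X. ev x (from_coords h) = h x)"
    unfolding from_coords_def by (rule someI_ex) (use ev_surj[of h] in blast)
  then show "from_coords h \<in> carrier A" "x \<in> X \<Longrightarrow> ev x (from_coords h) = h x"
    by auto
qed

text \<open>Both gradings of the theorem have this form: \<open>deg\<close> sends a group element to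
  its coset, or an index pair \<open>(i, j)\<close> to the degree of the matrix unit at that
  position.\<close>

definition component :: "('x \<Rightarrow> 'g) \<Rightarrow> 'g \<Rightarrow> 'a set" where
  "component deg \<gamma> = {a \<in> carrier A. \<forall>x\<in>X. ev x a \<noteq> 0 \<longrightarrow> deg x = \<gamma>}"

section \<open>The grading defined by a degree function on the coordinates\<close>

lemma submodule_component: "Module.submodule (component deg \<gamma>) (class_ring :: complex ring) A"
proof (rule submoduleI)
  fix a b assume "a \<in> component deg \<gamma>" "b \<in> component deg \<gamma>"
  then show "a \<oplus>\<^bsub>A\<^esub> b \<in> component deg \<gamma>"
    by (auto simp: component_def ev_add)
qed (auto simp: component_def ev_zero ev_minus ev_smult smult_mem)

text \<open>The part of degree \<gamma> keeps the coordinates of degree \<gamma> and replaces the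
  others by 0. It is unique because coordinate \<open>x\<close> of a sum of homogeneous parts comes
  from the part of degree \<open>deg x\<close> alone.\<close>

lemma decomposition_unique_exists:
  assumes deg: "deg \<in> X \<rightarrow> carrier \<Gamma>" and a: "a \<in> carrier A"
  shows "\<exists>!f. f \<in> (\<Pi>\<^sub>E \<gamma>\<in>carrier \<Gamma>. component deg \<gamma>) \<and>
        finite {\<gamma> \<in> carrier \<Gamma>. f \<gamma> \<noteq> \<zero>\<^bsub>A\<^esub>} \<and>
        a = (\<Oplus>\<^bsub>A\<^esub>\<gamma>\<in>{\<gamma> \<in> carrier \<Gamma>. f \<gamma> \<noteq> \<zero>\<^bsub>A\<^esub>}. f \<gamma>)" (is "\<exists>!f. ?P f")
proof
  have char: "ev x (\<Oplus>\<^bsub>A\<^esub>\<gamma>\<in>{\<gamma> \<in> carrier \<Gamma>. f \<gamma> \<noteq> \<zero>\<^bsub>A\<^esub>}. f \<gamma>) = ev x (f (deg x))"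
    if f: "f \<in> (\<Pi>\<^sub>E \<gamma>\<in>carrier \<Gamma>. component deg \<gamma>)"
      and fin: "finite {\<gamma> \<in> carrier \<Gamma>. f \<gamma> \<noteq> \<zero>\<^bsub>A\<^esub>}" and x: "x \<in> X" for f x
  proof -
    have "ev x (\<Oplus>\<^bsub>A\<^esub>\<gamma>\<in>{\<gamma> \<in> carrier \<Gamma>. f \<gamma> \<noteq> \<zero>\<^bsub>A\<^esub>}. f \<gamma>)
        = (\<Sum>\<gamma>\<in>{\<gamma> \<in> carrier \<Gamma>. f \<gamma> \<noteq> \<zero>\<^bsub>A\<^esub>}. ev x (f \<gamma>))"
      using f x by (intro ev_finsum) (auto simp: component_def)
    also have "\<dots> = (\<Sum>\<gamma>\<in>{\<gamma> \<in> carrier \<Gamma>. f \<gamma> \<noteq> \<zero>\<^bsub>A\<^esub>}. if \<gamma> = deg x then ev x (f (deg x)) else 0)"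
      using f x by (intro sum.cong) (auto simp: component_def PiE_iff)
    \<comment> \<open>If \<open>f (deg x)\<close> is zero, then \<open>deg x\<close> is missing from
      the index set, and both sides are 0.\<close>
    also have "\<dots> = ev x (f (deg x))"
      using fin x deg by (auto simp: sum.delta ev_zero)
    finally show ?thesis .
  qed
  let ?f = "\<lambda>\<gamma>\<in>carrier \<Gamma>. from_coords (\<lambda>x. if deg x = \<gamma> then ev x a else 0)"
  have fP: "?f \<in> (\<Pi>\<^sub>E \<gamma>\<in>carrier \<Gamma>. component deg \<gamma>)"
    by (auto simp: component_def from_coords)
  have fF: "finite {\<gamma> \<in> carrier \<Gamma>. ?f \<gamma> \<noteq> \<zero>\<^bsub>A\<^esub>}"
  proof (rule finite_subset)
    show "{\<gamma> \<in> carrier \<Gamma>. ?f \<gamma> \<noteq> \<zero>\<^bsub>A\<^esub>} \<subseteq> deg ` X"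
    proof
      fix \<gamma> assume g: "\<gamma> \<in> {\<gamma> \<in> carrier \<Gamma>. ?f \<gamma> \<noteq> \<zero>\<^bsub>A\<^esub>}"
      show "\<gamma> \<in> deg ` X"
      proof (rule ccontr)
        assume n: "\<gamma> \<notin> deg ` X"
        have "?f \<gamma> = \<zero>\<^bsub>A\<^esub>"
          using g n by (intro ev_ext) (auto simp: from_coords ev_zero)
        with g show False by auto
      qed
    qed
  qed (simp add: finite_X)
  have "a = (\<Oplus>\<^bsub>A\<^esub>\<gamma>\<in>{\<gamma> \<in> carrier \<Gamma>. ?f \<gamma> \<noteq> \<zero>\<^bsub>A\<^esub>}. ?f \<gamma>)"
  proof (rule ev_ext)
    show "(\<Oplus>\<^bsub>A\<^esub>\<gamma>\<in>{\<gamma> \<in> carrier \<Gamma>. ?f \<gamma> \<noteq> \<zero>\<^bsub>A\<^esub>}. ?f \<gamma>) \<in> carrier A"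
      by (intro M.finsum_closed) (auto simp: from_coords)
    fix x assume x: "x \<in> X"
    then show "ev x a = ev x (\<Oplus>\<^bsub>A\<^esub>\<gamma>\<in>{\<gamma> \<in> carrier \<Gamma>. ?f \<gamma> \<noteq> \<zero>\<^bsub>A\<^esub>}. ?f \<gamma>)"
      using deg by (subst char[OF fP fF x]) (auto simp: from_coords Pi_iff)
  qed (rule a)
  with fP fF show "?P ?f" by blast
  fix f assume f: "?P f"
  show "f = ?f"
  proof (rule PiE_ext[OF _ fP])
    show "f \<in> (\<Pi>\<^sub>E \<gamma>\<in>carrier \<Gamma>. component deg \<gamma>)" using f by blast
    fix \<gamma> assume g: "\<gamma> \<in> carrier \<Gamma>"
    show "f \<gamma> = ?f \<gamma>"
    proof (rule ev_ext)
      have fg: "f \<gamma> \<in> component deg \<gamma>" using f g by blast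
      then show "f \<gamma> \<in> carrier A" by (simp add: component_def)
      show "?f \<gamma> \<in> carrier A" using g by (simp add: from_coords)
      fix x assume x: "x \<in> X"
      have "ev x a = ev x (f (deg x))"
        using char[of f x] f x by metis
      then show "ev x (f \<gamma>) = ev x (?f \<gamma>)"
        using fg x g by (auto simp: component_def from_coords)
    qed
  qed
qed

lemma is_gradingI:
  assumes "alg \<A> = A" "grading_group \<A> = \<Gamma>" "group \<Gamma>" "complex_algebra A"
    and deg: "deg \<in> X \<rightarrow> carrier \<Gamma>"
    and hc: "\<And>\<gamma>. \<gamma> \<in> carrier \<Gamma> \<Longrightarrow> hcomp \<A> \<gamma> = component deg \<gamma>"
    and mult: "\<And>\<gamma> \<delta> a b. \<lbrakk>\<gamma> \<in> carrier \<Gamma>; \<delta> \<in> carrier \<Gamma>; a \<in> component deg \<gamma>; b \<in> component deg \<delta>\<rbrakk>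
        \<Longrightarrow> a \<otimes>\<^bsub>A\<^esub> b \<in> component deg (\<gamma> \<otimes>\<^bsub>\<Gamma>\<^esub> \<delta>)"
  shows "is_grading \<A>"
proof -
  interpret \<Gamma>: group \<Gamma> by fact
  have PiE: "(\<Pi>\<^sub>E \<gamma>\<in>carrier \<Gamma>. hcomp \<A> \<gamma>) = (\<Pi>\<^sub>E \<gamma>\<in>carrier \<Gamma>. component deg \<gamma>)"
    by (rule PiE_cong) (rule hc)
  show ?thesis
    unfolding is_grading_def Let_def assms(1,2) PiE
    using assms(3,4) decomposition_unique_exists[OF deg] mult hc
    by (simp add: submodule_component)
qed

end

section \<open>Injective linear maps in coordinates\<close>

locale coordinates_hom = A: coordinates A X ev + B: coordinates B Y ev'
  for A :: "(complex, 'a) module" and X :: "'x set" and ev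
    and B :: "(complex, 'b) module" and Y :: "'y set" and ev' +
  fixes \<psi> :: "'a \<Rightarrow> 'b"
  assumes closed: "a \<in> carrier A \<Longrightarrow> \<psi> a \<in> carrier B"
    and add: "\<lbrakk>a \<in> carrier A; b \<in> carrier A\<rbrakk> \<Longrightarrow> \<psi> (a \<oplus>\<^bsub>A\<^esub> b) = \<psi> a \<oplus>\<^bsub>B\<^esub> \<psi> b"
    and smult: "a \<in> carrier A \<Longrightarrow> \<psi> (c \<odot>\<^bsub>A\<^esub> a) = c \<odot>\<^bsub>B\<^esub> \<psi> a"
    and inj: "inj_on \<psi> (carrier A)"
begin

text \<open>Row \<open>x\<close> holds the coordinates of the image of the basis vector at
  \<open>x\<close>. The value 0 outside \<open>Y\<close> gives every row the support condition of
  \<open>independent_functions\<close>.\<close>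

definition matrix_entry :: "'x \<Rightarrow> 'y \<Rightarrow> complex" where
  "matrix_entry x y = (if y \<in> Y then ev' y (\<psi> (A.from_coords (tga_basis x))) else 0)"

text \<open>Expand \<open>a\<close> in the basis \<open>from_coords (tga_basis x)\<close>, where
  \<open>tga_basis x\<close> serves as the unit vector at an arbitrary index, and use
  linearity.\<close>

lemma ev'_hom:
  assumes a: "a \<in> carrier A" and y: "y \<in> Y"
  shows "ev' y (\<psi> a) = (\<Sum>x\<in>X. ev x a * matrix_entry x y)"
proof -
  let ?e = "\<lambda>x. ev x a \<odot>\<^bsub>A\<^esub> A.from_coords (tga_basis x)"
  have e: "?e \<in> X \<rightarrow> carrier A"
    by (auto intro!: A.smult_mem A.from_coords)
  have "a = (\<Oplus>\<^bsub>A\<^esub>x\<in>X. ?e x)"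
  proof (rule A.ev_ext[OF a])
    show "(\<Oplus>\<^bsub>A\<^esub>x\<in>X. ?e x) \<in> carrier A"
      using e by (rule A.M.finsum_closed)
    fix x assume x: "x \<in> X"
    have "ev x (\<Oplus>\<^bsub>A\<^esub>x\<in>X. ?e x) = (\<Sum>z\<in>X. ev x (?e z))"
      using x e by (rule A.ev_finsum)
    also have "\<dots> = (\<Sum>z\<in>X. if x = z then ev x a else 0)"
      using x by (intro sum.cong) (auto simp: A.ev_smult A.from_coords tga_basis_def)
    also have "\<dots> = ev x a"
      using x A.finite_X by simp
    finally show "ev x a = ev x (\<Oplus>\<^bsub>A\<^esub>x\<in>X. ?e x)" ..
  qed
  then have "ev' y (\<psi> a) = ev' y (\<psi> (\<Oplus>\<^bsub>A\<^esub>x\<in>X. ?e x))"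
    by simp
  also have "\<dots> = (\<Sum>x\<in>X. ev' y (\<psi> (?e x)))"
    using e y by (intro A.M.additive_finsum[of "\<lambda>a. ev' y (\<psi> a)"]) (auto simp: add closed B.ev_add)
  also have "\<dots> = (\<Sum>x\<in>X. ev x a * matrix_entry x y)"
    using y by (intro sum.cong) (auto simp: smult A.from_coords closed B.ev_smult matrix_entry_def)
  finally show ?thesis .
qed

text \<open>A linear relation between the rows is the coordinate vector of an element of the kernel,
  which injectivity makes zero.\<close>

lemma matrix_entry_independent:
  assumes "\<And>y. (\<Sum>x\<in>X. c x * matrix_entry x y) = 0"
  shows "\<forall>x\<in>X. c x = 0"
proof -
  let ?a = "A.from_coords c"
  have zero: "\<psi> \<zero>\<^bsub>A\<^esub> = \<zero>\<^bsub>B\<^esub>"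
    using add[of "\<zero>\<^bsub>A\<^esub>" "\<zero>\<^bsub>A\<^esub>"] closed[of "\<zero>\<^bsub>A\<^esub>"] B.M.add.l_cancel_one by simp
  have "\<psi> ?a = \<psi> \<zero>\<^bsub>A\<^esub>"
  proof (rule B.ev_ext)
    fix y assume "y \<in> Y"
    then show "ev' y (\<psi> ?a) = ev' y (\<psi> \<zero>\<^bsub>A\<^esub>)"
      using assms[of y] by (simp add: zero B.ev_zero ev'_hom A.from_coords)
  qed (simp_all add: closed A.from_coords)
  then have "?a = \<zero>\<^bsub>A\<^esub>"
    by (intro inj_onD[OF inj]) (auto simp: A.from_coords)
  then show ?thesis
    using A.from_coords(2)[of _ c] A.ev_zero by metis
qed

lemma card_le: "card X \<le> card Y"
  by (rule independent_functions(1)[where b = matrix_entry, OF A.finite_X B.finite_X])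
    (simp add: matrix_entry_def, rule matrix_entry_independent)

text \<open>In equal dimensions the independent rows span, so the coordinates of any
  \<open>b\<close> are a combination of rows, and its coefficients are the coordinates of a
  preimage.\<close>

lemma bij_betw_of_card_eq:
  assumes "card X = card Y"
  shows "bij_betw \<psi> (carrier A) (carrier B)"
  unfolding bij_betw_def
proof (intro conjI inj subset_antisym image_subsetI closed subsetI)
  fix b assume b: "b \<in> carrier B"
  have "\<exists>c. \<forall>y. (if y \<in> Y then ev' y b else 0) = (\<Sum>x\<in>X. c x * matrix_entry x y)"
    by (rule independent_functions(2)[OF A.finite_X B.finite_X _ matrix_entry_independent assms])
      (auto simp: matrix_entry_def)
  then obtain c where c: "\<And>y. (if y \<in> Y then ev' y b else 0) = (\<Sum>x\<in>X. c x * matrix_entry x y)"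
    by blast
  have "b = \<psi> (A.from_coords c)"
  proof (rule B.ev_ext[OF b])
    fix y assume "y \<in> Y"
    then show "ev' y b = ev' y (\<psi> (A.from_coords c))"
      using c[of y] by (simp add: ev'_hom A.from_coords)
  qed (simp add: closed A.from_coords)
  then show "b \<in> \<psi> ` carrier A"
    using A.from_coords(1) by blast
qed

text \<open>The inverse is again injective and linear, so \<open>card_le\<close> applies in both
  directions.\<close>

lemma card_eq_of_bij_betw:
  assumes "bij_betw \<psi> (carrier A) (carrier B)"
  shows "card X = card Y"
proof -
  let ?\<theta> = "inv_into (carrier A) \<psi>"
  have img: "\<psi> ` carrier A = carrier B"
    using assms by (simp add: bij_betw_def)
  have inv: "?\<theta> b \<in> carrier A" "\<psi> (?\<theta> b) = b" if "b \<in> carrier B" for b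
    using that img by (auto intro: inv_into_into f_inv_into_f)
  have eqI: "a = b" if "a \<in> carrier A" "b \<in> carrier A" "\<psi> a = \<psi> b" for a b
    using inj that by (auto dest: inj_onD)
  interpret inv: coordinates_hom B Y ev' A X ev ?\<theta>
  proof
    show "inj_on ?\<theta> (carrier B)"
      using img by (simp add: inj_on_inv_into)
  qed (auto intro!: eqI simp: inv add smult A.smult_mem B.smult_mem)
  show ?thesis
    using card_le inv.card_le by simp
qed

end

section \<open>Elementary gradings\<close>

lemma complex_algebra_mat: "complex_algebra (module_mat TYPE(complex) r r)"
proof -
  \<comment> \<open>As a ring record, \<open>module_mat\<close> is \<open>ring_mat\<close> with the
    scalar multiplication in its extension slot, so the ring laws carry over.\<close>
  have "module_mat TYPE(complex) r r = ring_mat TYPE(complex) r (ring.more (module_mat TYPE(complex) r r))"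
    by (simp add: module_mat_def ring_mat_def)
  then have "ring (module_mat TYPE(complex) r r)"
    using ring_mat by metis
  moreover have "Module.module (class_ring :: complex ring) (module_mat TYPE(complex) r r)"
    using matrix_vs by (rule vectorspace.axioms)
  ultimately show ?thesis
    by (auto simp: complex_algebra_def module_mat_simps mult_smult_assoc_mat mult_smult_distrib)
qed

lemma coordinates_mat:
  "coordinates (module_mat TYPE(complex) r r) ({..<r} \<times> {..<r}) (\<lambda>p M. M $$ p)"
proof -
  interpret Module.module "class_ring :: complex ring" "module_mat TYPE(complex) r r"
    using complex_algebra_mat by (simp add: complex_algebra_def)
  show ?thesis
  proof
    fix h :: "nat \<times> nat \<Rightarrow> complex"
    show "\<exists>a\<in>carrier (module_mat TYPE(complex) r r). \<forall>x\<in>{..<r} \<times> {..<r}. a $$ x = h x"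
      by (rule bexI[of _ "Matrix.mat r r h"]) (auto simp: module_mat_simps)
  qed (auto simp: module_mat_simps)
qed

text \<open>A nonzero entry \<open>(i, j)\<close> of a product needs some \<open>k\<close> with
  nonzero entries at \<open>(i, k)\<close> and \<open>(k, j)\<close>, and the product of their
  degrees telescopes to the degree of \<open>(i, j)\<close>.\<close>

lemma is_grading_elementary:
  fixes G :: "'g monoid" (structure)
  assumes "group G" and gs: "set gs \<subseteq> carrier G"
  shows "is_grading (elementary_grading G gs)"
proof -
  interpret group G by fact
  let ?r = "length gs"
  let ?deg = "\<lambda>(i, j). gs ! i \<otimes> inv (gs ! j)"
  interpret M: coordinates "module_mat TYPE(complex) ?r ?r" "{..<?r} \<times> {..<?r}" "\<lambda>p M. M $$ p"
    by (rule coordinates_mat)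
  have mem: "gs ! i \<in> carrier G" if "i < ?r" for i
    using gs that by auto
  have comp: "hcomp (elementary_grading G gs) \<gamma> = M.component ?deg \<gamma>" for \<gamma>
    by (auto simp: elementary_grading_def M.component_def Let_def module_mat_simps)
  show ?thesis
  proof (rule M.is_gradingI)
    fix \<gamma> \<delta> a b
    assume a: "a \<in> M.component ?deg \<gamma>" and b: "b \<in> M.component ?deg \<delta>"
    then have ab: "a \<in> carrier_mat ?r ?r" "b \<in> carrier_mat ?r ?r"
      by (auto simp: M.component_def module_mat_simps)
    have "gs ! i \<otimes> inv (gs ! j) = \<gamma> \<otimes> \<delta>"
      if ij: "i < ?r" "j < ?r" and nz: "(a * b) $$ (i, j) \<noteq> 0" for i j
    proof -
      have "(a * b) $$ (i, j) = (\<Sum>k<?r. a $$ (i, k) * b $$ (k, j))"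
        using ab ij by (auto simp: scalar_prod_def atLeast0LessThan intro!: sum.cong)
      then obtain k where k: "k < ?r" "a $$ (i, k) \<noteq> 0" "b $$ (k, j) \<noteq> 0"
        using nz by (metis (no_types, lifting) lessThan_iff mult_eq_0_iff sum.neutral)
      then have g: "gs ! i \<otimes> inv (gs ! k) = \<gamma>" "gs ! k \<otimes> inv (gs ! j) = \<delta>"
        using a b ij by (auto simp: M.component_def)
      show ?thesis
        using mem ij k(1) by (simp flip: g add: m_assoc) (simp flip: m_assoc)
    qed
    then show "a \<otimes>\<^bsub>module_mat TYPE(complex) ?r ?r\<^esub> b \<in> M.component ?deg (\<gamma> \<otimes> \<delta>)"
      using ab by (auto simp: M.component_def module_mat_simps)
  qed (use mem comp in \<open>auto simp: elementary_grading_def Let_def complex_algebra_mat\<close>)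
qed

section \<open>Twisted group algebras\<close>

text \<open>The algebra laws are assumed here because \<open>simple_algebra\<close>, and hence
  \<open>nondegenerate\<close>, already contains them.\<close>

locale twisted_group = group G
  for G :: "'g monoid" (structure) +
  fixes \<alpha> :: "'g \<Rightarrow> 'g \<Rightarrow> complex"
  assumes finite_G: "finite (carrier G)"
    and cocycle: "two_cocycle G \<alpha>"
    and complex_algebra: "complex_algebra (twisted_group_algebra G \<alpha>)"
begin

abbreviation A where "A \<equiv> twisted_group_algebra G \<alpha>"

lemma alpha_nonzero: "\<lbrakk>g \<in> carrier G; h \<in> carrier G\<rbrakk> \<Longrightarrow> \<alpha> g h \<noteq> 0"
  using cocycle by (simp add: two_cocycle_def)

lemma alpha_assoc:
  "\<lbrakk>g \<in> carrier G; h \<in> carrier G; k \<in> carrier G\<rbrakk> \<Longrightarrow>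
     \<alpha> g h * \<alpha> (g \<otimes> h) k = \<alpha> g (h \<otimes> k) * \<alpha> h k"
  using cocycle by (simp add: two_cocycle_def)

lemma coordinates_A: "coordinates A (carrier G) (\<lambda>g f. f g)"
proof -
  interpret Module.module "class_ring :: complex ring" A
    using complex_algebra by (simp add: complex_algebra_def)
  show ?thesis
  proof
    fix h :: "'g \<Rightarrow> complex"
    show "\<exists>a\<in>carrier A. \<forall>x\<in>carrier G. a x = h x"
      by (rule bexI[of _ "\<lambda>x. if x \<in> carrier G then h x else 0"])
        (auto simp: twisted_group_algebra_def)
  next
    fix a b
    assume "a \<in> carrier A" "b \<in> carrier A" "\<And>x. x \<in> carrier G \<Longrightarrow> a x = b x"
    then have "a x = b x" for x
      by (cases "x \<in> carrier G") (auto simp: twisted_group_algebra_def)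
    then show "a = b" ..
  qed (auto simp: twisted_group_algebra_def finite_G)
qed

sublocale A: coordinates A "carrier G" "\<lambda>g f. f g"
  by (rule coordinates_A)

lemma tga_basis_carrier: "g \<in> carrier G \<Longrightarrow> tga_basis g \<in> carrier A"
  by (auto simp: twisted_group_algebra_def tga_basis_def)

lemma mult_apply:
  "(a \<otimes>\<^bsub>A\<^esub> b) x = (\<Sum>(g, h) | g \<in> carrier G \<and> h \<in> carrier G \<and> g \<otimes> h = x. a g * b h * \<alpha> g h)"
  by (simp add: twisted_group_algebra_def)

lemma tga_basis_mult:
  assumes "g \<in> carrier G" "h \<in> carrier G"
  shows "tga_basis g \<otimes>\<^bsub>A\<^esub> tga_basis h = \<alpha> g h \<odot>\<^bsub>A\<^esub> tga_basis (g \<otimes> h)"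
proof
  fix x
  let ?I = "{(a, b). a \<in> carrier G \<and> b \<in> carrier G \<and> a \<otimes> b = x}"
  have fin: "finite ?I"
    by (rule finite_subset[OF _ finite_cartesian_product[OF finite_G finite_G]]) auto
  have "(tga_basis g \<otimes>\<^bsub>A\<^esub> tga_basis h) x = (\<Sum>p\<in>?I. if p = (g, h) then \<alpha> g h else 0)"
    unfolding mult_apply by (rule sum.cong) (auto simp: tga_basis_def split: if_splits)
  also have "\<dots> = (if g \<otimes> h = x then \<alpha> g h else 0)"
    using fin assms by simp
  also have "\<dots> = (\<alpha> g h \<odot>\<^bsub>A\<^esub> tga_basis (g \<otimes> h)) x"
    by (auto simp: twisted_group_algebra_def tga_basis_def)
  finally show "(tga_basis g \<otimes>\<^bsub>A\<^esub> tga_basis h) x = (\<alpha> g h \<odot>\<^bsub>A\<^esub> tga_basis (g \<otimes> h)) x" .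
qed

lemma one_eq: "\<one>\<^bsub>A\<^esub> = inverse (\<alpha> \<one> \<one>) \<odot>\<^bsub>A\<^esub> tga_basis \<one>"
  by (auto simp: twisted_group_algebra_def tga_basis_def fun_eq_iff)

text \<open>Replaces finite sums of homogeneous elements by a support condition. For the harder
  inclusion, \<open>S\<close> itself is finite and can index the sum, with summands
  \<open>a g\<close> times \<open>u_g\<close>.\<close>

lemma hcomp_quotient:
  assumes S: "S \<subseteq> carrier G"
  shows "hcomp (quotient_grading (twisted_grading G \<alpha>) N) S
    = {a \<in> carrier A. \<forall>x\<in>carrier G. a x \<noteq> 0 \<longrightarrow> x \<in> S}" (is "?L = ?R")
proof (rule subset_antisym; rule subsetI)
  let ?C = "hcomp (twisted_grading G \<alpha>)"
  have C: "?C g = {c \<odot>\<^bsub>A\<^esub> tga_basis g | c. True}" for g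
    by (simp add: twisted_grading_def)
  have ev: "(c \<odot>\<^bsub>A\<^esub> tga_basis g) x = (if x = g then c else 0)" for c g x
    by (simp add: twisted_group_algebra_def tga_basis_def)
  have L: "?L = {\<Oplus>\<^bsub>A\<^esub>g\<in>F. f g | F f. finite F \<and> F \<subseteq> S \<and> f \<in> (\<Pi> g\<in>F. ?C g)}"
    by (simp add: quotient_grading_def twisted_grading_def)
  {
    fix a assume "a \<in> ?L"
    then obtain F f where a: "a = (\<Oplus>\<^bsub>A\<^esub>g\<in>F. f g)" and F: "finite F" "F \<subseteq> S"
      and f: "\<And>g. g \<in> F \<Longrightarrow> f g \<in> ?C g"
      unfolding L by auto
    have fA: "f \<in> F \<rightarrow> carrier A"
      using f F S unfolding C by (force intro: A.smult_mem tga_basis_carrier)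
    have "a x = 0" if "x \<in> carrier G" "x \<notin> S" for x
    proof -
      have "a x = (\<Sum>g\<in>F. f g x)"
        unfolding a using that(1) fA by (rule A.ev_finsum)
      also have "\<dots> = 0"
        using f F that unfolding C by (intro sum.neutral ballI) (force simp: ev)
      finally show ?thesis .
    qed
    moreover have "a \<in> carrier A"
      unfolding a using fA by (rule A.M.finsum_closed)
    ultimately show "a \<in> ?R" by auto
  next
    fix a assume a: "a \<in> ?R"
    let ?f = "\<lambda>g. a g \<odot>\<^bsub>A\<^esub> tga_basis g"
    have fA: "?f \<in> S \<rightarrow> carrier A"
      using S by (auto intro: A.smult_mem tga_basis_carrier)
    have "a = (\<Oplus>\<^bsub>A\<^esub>g\<in>S. ?f g)"
    proof (rule A.ev_ext)
      fix x assume x: "x \<in> carrier G"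
      have "(\<Oplus>\<^bsub>A\<^esub>g\<in>S. ?f g) x = (\<Sum>g\<in>S. ?f g x)"
        using x fA by (rule A.ev_finsum)
      also have "\<dots> = a x"
        using a x finite_subset[OF S finite_G] by (auto simp: ev)
      finally show "a x = (\<Oplus>\<^bsub>A\<^esub>g\<in>S. ?f g) x" ..
    qed (use a fA in \<open>auto intro: A.M.finsum_closed\<close>)
    moreover have "?f \<in> (\<Pi> g\<in>S. ?C g)"
      unfolding C by auto
    ultimately show "a \<in> ?L"
      unfolding L using finite_subset[OF S finite_G] by blast
  }
qed

end

section \<open>The quotient grading by a normal subgroup\<close>

locale twisted_group_normal = twisted_group G \<alpha> + normal N G
  for G :: "'g monoid" (structure) and \<alpha> and N
begin

abbreviation Q where "Q \<equiv> quotient_grading (twisted_grading G \<alpha>) N"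

lemma rcosets_eq: "S \<in> rcosets N \<Longrightarrow> x \<in> carrier G \<Longrightarrow> x \<in> S \<longleftrightarrow> N #> x = S"
  using rcos_self[OF _ is_subgroup] repr_independence[OF _ _ is_subgroup]
  by (auto simp: RCOSETS_def)

text \<open>The basis vector at \<open>x\<close> gets degree \<open>N #> x\<close>; products respect
  degrees because \<open>x\<close> maps to its coset homomorphically.\<close>

lemma is_grading_quotient: "is_grading Q"
proof (rule A.is_gradingI[where \<Gamma> = "G Mod N" and deg = "\<lambda>x. N #> x"])
  show "alg Q = A" "grading_group Q = G Mod N"
    by (simp_all add: quotient_grading_def twisted_grading_def)
  show "group (G Mod N)"
    by (rule factorgroup_is_group)
  show "complex_algebra A"
    by (rule complex_algebra)
  show "(\<lambda>x. N #> x) \<in> carrier G \<rightarrow> carrier (G Mod N)"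
    by (auto simp: carrier_FactGroup)
  show "hcomp Q S = A.component (\<lambda>x. N #> x) S" if "S \<in> carrier (G Mod N)" for S
  proof -
    have S: "S \<in> rcosets N"
      using that by (simp add: FactGroup_def)
    then have "S \<subseteq> carrier G"
      using rcosets_carrier by blast
    then show ?thesis
      using S by (auto simp: hcomp_quotient A.component_def rcosets_eq)
  qed
  fix S T a b
  assume a: "a \<in> A.component (\<lambda>x. N #> x) S" and b: "b \<in> A.component (\<lambda>x. N #> x) T"
  have "N #> x = S <#> T" if "x \<in> carrier G" and nz: "(a \<otimes>\<^bsub>A\<^esub> b) x \<noteq> 0" for x
  proof -
    obtain g h where gh: "g \<in> carrier G" "h \<in> carrier G" "g \<otimes> h = x" "a g \<noteq> 0" "b h \<noteq> 0"
      using nz unfolding mult_apply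
      by (auto elim!: sum.not_neutral_contains_not_neutral)
    then have "N #> g = S" "N #> h = T"
      using a b by (auto simp: A.component_def)
    then show ?thesis
      using rcos_sum[OF gh(1,2)] gh(3) by simp
  qed
  moreover have "a \<otimes>\<^bsub>A\<^esub> b \<in> carrier A"
    using a b complex_algebra by (auto simp: complex_algebra_def ring_def A.component_def intro: monoid.m_closed)
  ultimately show "a \<otimes>\<^bsub>A\<^esub> b \<in> A.component (\<lambda>x. N #> x) (S \<otimes>\<^bsub>G Mod N\<^esub> T)"
    by (simp add: A.component_def)
qed

end

section \<open>From an elementary crossed product to a Lagrangian\<close>

text \<open>The hypotheses concern only row \<open>i\<close> of \<open>M\<close> and column
  \<open>j\<close> of \<open>M'\<close>: the first kills all terms but \<open>k = i\<close>, the
  second kills that one unless \<open>i = j\<close>.\<close>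

lemma diagonal_mult_index:
  fixes M M' :: "'a :: semiring_0 mat"
  assumes "M \<in> carrier_mat r r" "M' \<in> carrier_mat r r" "i < r" "j < r"
    and diag: "\<And>k. k < r \<Longrightarrow> k \<noteq> i \<Longrightarrow> M $$ (i, k) = 0" "\<And>k. k < r \<Longrightarrow> k \<noteq> j \<Longrightarrow> M' $$ (k, j) = 0"
  shows "(M * M') $$ (i, j) = (if i = j then M $$ (i, i) * M' $$ (i, i) else 0)"
proof -
  have "(M * M') $$ (i, j) = (\<Sum>k<r. M $$ (i, k) * M' $$ (k, j))"
    using assms(1-4) by (auto simp: scalar_prod_def atLeast0LessThan intro!: sum.cong)
  also have "\<dots> = (\<Sum>k<r. if k = i then M $$ (i, i) * M' $$ (i, j) else 0)"
    using diag(1) by (intro sum.cong) auto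
  also have "\<dots> = (if i = j then M $$ (i, i) * M' $$ (i, i) else 0)"
    using assms(3,4) diag(2) by auto
  finally show ?thesis .
qed

context twisted_group_normal
begin

lemma N_mem: "n \<in> N \<Longrightarrow> n \<in> carrier G"
  using subset by blast

lemma lagrangian_of_crossed_product:
  assumes "elementary_crossed_product_class Q"
  shows "(card N)\<^sup>2 = Coset.order G" "comm_group (G\<lparr>carrier := N\<rparr>)"
    and "cohomologous (G\<lparr>carrier := N\<rparr>) \<alpha> (\<lambda>_ _. 1)"
proof -
  obtain \<Gamma> :: "'g set monoid" and gs \<psi> \<phi> where "group \<Gamma>"
    and gs: "distinct gs" "set gs = carrier \<Gamma>"
    and \<psi>: "\<psi> \<in> algebra_iso A (alg (elementary_grading \<Gamma> gs))"
    and \<phi>: "\<phi> \<in> iso (G Mod N) (grading_group (elementary_grading \<Gamma> gs))"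
    and \<psi>\<phi>: "\<And>S. S \<in> carrier (G Mod N) \<Longrightarrow> \<psi> ` hcomp Q S \<subseteq> hcomp (elementary_grading \<Gamma> gs) (\<phi> S)"
    using assms unfolding elementary_crossed_product_class_def graded_equivalent_def
    by (auto simp: quotient_grading_def twisted_grading_def)
  interpret \<Gamma>: group \<Gamma> by fact
  define r where "r = length gs"
  define B where "B = module_mat TYPE(complex) r r"
  have \<psi>: "\<psi> \<in> ring_iso A B" and \<psi>_smult: "\<And>c a. a \<in> carrier A \<Longrightarrow> \<psi> (c \<odot>\<^bsub>A\<^esub> a) = c \<odot>\<^bsub>B\<^esub> \<psi> a"
    using \<psi> by (simp_all add: algebra_iso_def elementary_grading_def Let_def B_def r_def)
  have \<phi>: "\<phi> \<in> iso (G Mod N) \<Gamma>"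
    using \<phi> by (simp add: elementary_grading_def Let_def)
  note \<psi>_hom = ring_iso_memE[OF \<psi>]
  interpret H: coordinates_hom A "carrier G" "\<lambda>g f. f g" B "{..<r} \<times> {..<r}" "\<lambda>p M. M $$ p" \<psi>
    by (intro coordinates_hom.intro coordinates_hom_axioms.intro coordinates_A)
      (use \<psi>_hom \<psi>_smult coordinates_mat in \<open>auto simp: B_def bij_betw_def\<close>)
  have "card (carrier G) = r * r"
    using H.card_eq_of_bij_betw[OF \<psi>_hom(5)] by (simp add: card_cartesian_product)
  moreover have "card (rcosets N) = r"
  proof -
    have "card (carrier (G Mod N)) = card (carrier \<Gamma>)"
      using \<phi> by (auto simp: iso_def intro: bij_betw_same_card)
    then show ?thesis
      using gs by (simp add: FactGroup_def r_def flip: distinct_card)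
  qed
  moreover have "card (rcosets N) * card N = Coset.order G"
    using lagrange_finite[OF finite_G is_subgroup] by simp
  \<comment> \<open>Allows cancelling \<open>r\<close> in \<open>r * card N = r * r\<close>; later
    it ensures that the diagonal position 0 exists.\<close>
  moreover have "r > 0"
    using gs(2) \<Gamma>.one_closed by (auto simp: r_def)
  ultimately show "(card N)\<^sup>2 = Coset.order G"
    by (simp add: Coset.order_def power2_eq_square)
  define M where "M n = \<psi> (tga_basis n)" for n
  have M: "M n \<in> carrier_mat r r" if "n \<in> N" for n
    using \<psi>_hom(1)[OF tga_basis_carrier[OF N_mem[OF that]]] by (simp add: M_def B_def module_mat_simps)
  \<comment> \<open>The degree of \<open>u_n\<close> is the trivial coset, which \<phi> sends to the
    identity of \<Gamma>. The entries of \<open>gs\<close> are distinct, so no off-diagonal position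
    has that degree.\<close>
  have diag: "M n $$ (i, j) = 0" if n: "n \<in> N" and ij: "i < r" "j < r" "i \<noteq> j" for n i j
  proof -
    interpret \<phi>: group_hom "G Mod N" \<Gamma> \<phi>
      using \<phi> \<Gamma>.is_group factorgroup_is_group by (auto simp: group_hom_def group_hom_axioms_def iso_def)
    have "tga_basis n \<in> hcomp Q N"
      using n by (auto simp: hcomp_quotient[OF subset] tga_basis_carrier N_mem)
        (auto simp: tga_basis_def split: if_splits)
    moreover have "N \<in> carrier (G Mod N)"
      using \<phi>.G.one_closed by simp
    ultimately have "M n \<in> hcomp (elementary_grading \<Gamma> gs) (\<phi> N)"
      using \<psi>\<phi> unfolding M_def by blast
    moreover have "\<phi> N = \<one>\<^bsub>\<Gamma>\<^esub>"
      using \<phi>.hom_one by simp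
    moreover have "gs ! i \<otimes>\<^bsub>\<Gamma>\<^esub> inv\<^bsub>\<Gamma>\<^esub> (gs ! j) \<noteq> \<one>\<^bsub>\<Gamma>\<^esub>"
    proof
      have mem: "gs ! i \<in> carrier \<Gamma>" "gs ! j \<in> carrier \<Gamma>"
        using nth_mem[of i gs] nth_mem[of j gs] ij(1,2) unfolding r_def gs(2) by simp_all
      assume "gs ! i \<otimes>\<^bsub>\<Gamma>\<^esub> inv\<^bsub>\<Gamma>\<^esub> (gs ! j) = \<one>\<^bsub>\<Gamma>\<^esub>"
      then have "gs ! i = gs ! j"
        using mem by (metis \<Gamma>.inv_solve_right \<Gamma>.l_one \<Gamma>.one_closed)
      then show False
        using gs(1) ij by (simp add: r_def nth_eq_iff_index_eq)
    qed
    ultimately show ?thesis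
      using ij by (auto simp: elementary_grading_def Let_def r_def)
  qed
  have M_mult: "M n * M m = \<psi> (tga_basis n \<otimes>\<^bsub>A\<^esub> tga_basis m)" if "n \<in> N" "m \<in> N" for n m
    using that by (simp add: M_def \<psi>_hom(2) tga_basis_carrier N_mem B_def module_mat_simps)
  have M_mult_index: "(M n * M m) $$ (i, j) = (if i = j then M n $$ (i, i) * M m $$ (i, i) else 0)"
    if "n \<in> N" "m \<in> N" "i < r" "j < r" for n m i j
    using that by (intro diagonal_mult_index[OF M M]) (auto simp: diag)
  \<comment> \<open>Diagonal matrices commute, hence so do \<open>u_n\<close> and
    \<open>u_m\<close>. If \<open>n\<close> and \<open>m\<close> did not, the two products would be
    nonzero multiples of different basis vectors.\<close>
  have comm: "n \<otimes> m = m \<otimes> n" if nm: "n \<in> N" "m \<in> N" for n m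
  proof (rule ccontr)
    assume ne: "n \<otimes> m \<noteq> m \<otimes> n"
    have "M n * M m = M m * M n"
    proof (rule eq_matI)
      fix i j assume "i < dim_row (M m * M n)" "j < dim_col (M m * M n)"
      then have "i < r" "j < r"
        using M[OF nm(1)] M[OF nm(2)] by auto
      then show "(M n * M m) $$ (i, j) = (M m * M n) $$ (i, j)"
        unfolding M_mult_index[OF nm \<open>i < r\<close> \<open>j < r\<close>] M_mult_index[OF nm(2,1) \<open>i < r\<close> \<open>j < r\<close>]
        by (simp only: mult.commute)
    qed (use M[OF nm(1)] M[OF nm(2)] in auto)
    then have "\<psi> (tga_basis n \<otimes>\<^bsub>A\<^esub> tga_basis m) = \<psi> (tga_basis m \<otimes>\<^bsub>A\<^esub> tga_basis n)"
      using nm by (simp add: M_mult)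
    then have "tga_basis n \<otimes>\<^bsub>A\<^esub> tga_basis m = tga_basis m \<otimes>\<^bsub>A\<^esub> tga_basis n"
      using nm by (intro inj_onD[OF H.inj])
        (auto simp: tga_basis_mult N_mem intro!: A.smult_mem tga_basis_carrier)
    then have "(\<alpha> n m \<odot>\<^bsub>A\<^esub> tga_basis (n \<otimes> m)) (n \<otimes> m) = (\<alpha> m n \<odot>\<^bsub>A\<^esub> tga_basis (m \<otimes> n)) (n \<otimes> m)"
      using nm by (simp add: tga_basis_mult N_mem)
    then show False
      using ne nm alpha_nonzero[of n m] by (simp add: twisted_group_algebra_def tga_basis_def N_mem)
  qed
  have "group (G\<lparr>carrier := N\<rparr>)"
    by (rule subgroup_is_group[OF is_group])
  then show "comm_group (G\<lparr>carrier := N\<rparr>)"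
    by (rule group.group_comm_groupI) (simp add: comm)
  \<comment> \<open>Reading the diagonal entry at position 0 is multiplicative on diagonal matrices,
    so \<open>l\<close> is a one-dimensional representation of the twisted group algebra of
    \<open>N\<close>.\<close>
  define l where "l n = M n $$ (0, 0)" for n
  have M_smult: "\<psi> (c \<odot>\<^bsub>A\<^esub> tga_basis n) $$ (0, 0) = c * l n" if "n \<in> N" for c n
    using M[OF that] \<open>r > 0\<close>
    by (simp add: \<psi>_smult tga_basis_carrier N_mem that B_def module_mat_simps l_def M_def)
  have l_mult: "l n * l m = \<alpha> n m * l (n \<otimes> m)" if nm: "n \<in> N" "m \<in> N" for n m
    using M_mult_index[OF nm \<open>r > 0\<close> \<open>r > 0\<close>] nm
    by (simp add: M_mult tga_basis_mult N_mem M_smult l_def[of n, symmetric] l_def[of m, symmetric])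
  \<comment> \<open>The cocycle need not be normalised: the identity is a multiple of
    \<open>u_1\<close>, so this only yields that \<open>l\<close> is nonzero at the identity.
    Invertibility of \<alpha> then spreads this to all of \<open>N\<close> through \<open>n\<close>
    and \<open>inv n\<close>.\<close>
  have "inverse (\<alpha> \<one> \<one>) * l \<one> = \<psi> \<one>\<^bsub>A\<^esub> $$ (0, 0)"
    by (simp add: one_eq M_smult)
  also have "\<dots> = 1"
    using \<open>r > 0\<close> by (simp add: \<psi>_hom(4) B_def module_mat_simps)
  finally have l_one: "l \<one> \<noteq> 0"
    by auto
  have l_nonzero: "l n \<noteq> 0" if n: "n \<in> N" for n
  proof
    assume "l n = 0"
    then have "\<alpha> n (inv n) * l \<one> = 0"
      using l_mult[OF n m_inv_closed[OF n]] n by (simp add: N_mem)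
    then show False
      using l_one n by (simp add: alpha_nonzero N_mem)
  qed
  show "cohomologous (G\<lparr>carrier := N\<rparr>) \<alpha> (\<lambda>_ _. 1)"
    unfolding cohomologous_def
    by (intro exI[of _ l]) (auto simp: l_nonzero l_mult)
qed

end

section \<open>From a Lagrangian to an elementary crossed product\<close>

text \<open>\<open>l_mult\<close> is the triviality of \<alpha> on \<open>N\<close> with
  denominators cleared. It says that \<open>u_n\<close> acting as the scalar \<open>l n\<close>
  defines a one-dimensional module.\<close>

locale isotropic_normal = twisted_group_normal G \<alpha> N
  for G :: "'g monoid" (structure) and \<alpha> and N +
  fixes l :: "'g \<Rightarrow> complex"
  assumes l_nonzero: "n \<in> N \<Longrightarrow> l n \<noteq> 0"
    and l_mult: "\<lbrakk>n \<in> N; m \<in> N\<rbrakk> \<Longrightarrow> l n * l m = \<alpha> n m * l (n \<otimes> m)"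
begin

text \<open>The quotient group consists of right cosets, whereas inducing a left module needs the
  factor from \<open>N\<close> on the right; normality reconciles the two.\<close>

lemma rcos_eqE:
  assumes "g \<in> carrier G" "N #> g = N #> t" "t \<in> carrier G"
  obtains n where "n \<in> N" "g = t \<otimes> n"
  using rcos_self[OF assms(1) is_subgroup] coset_eq assms by (auto simp: l_coset_def)

lemma rcos_mult_N: "\<lbrakk>g \<in> carrier G; n \<in> N\<rbrakk> \<Longrightarrow> N #> (g \<otimes> n) = N #> g"
  by (rule repr_independence[OF _ _ is_subgroup, symmetric]) (auto simp: coset_eq l_coset_def)

section \<open>The monomial action on the induced module\<close>

definition rep :: "'g set \<Rightarrow> 'g" where
  "rep S = (SOME t. t \<in> carrier G \<and> N #> t = S)"

lemma rep: "S \<in> rcosets N \<Longrightarrow> rep S \<in> carrier G" "S \<in> rcosets N \<Longrightarrow> N #> rep S = S"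
proof -
  assume "S \<in> rcosets N"
  then have "\<exists>t. t \<in> carrier G \<and> N #> t = S"
    by (auto simp: RCOSETS_def)
  then have "rep S \<in> carrier G \<and> N #> rep S = S"
    unfolding rep_def by (rule someI_ex)
  then show "rep S \<in> carrier G" "N #> rep S = S"
    by auto
qed

text \<open>
  Let \<open>e = |N|\<^sup>-\<^sup>1 (\<Sum>n\<in>N. l(n)\<^sup>-\<^sup>1 u_n)\<close>, an idempotent with \<open>u_n e = l(n) e\<close>.  The weight is defined
  by \<open>u_g e = weight g \<cdot> u_t e\<close> for the representative \<open>t\<close> of the coset of \<open>g\<close>, and \<open>action g S\<close>
  is the coefficient of the action of \<open>u_g\<close> on the basis vector of the left ideal generated by
  \<open>e\<close> that belongs to the coset \<open>S\<close>.
\<close>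

definition weight :: "'g \<Rightarrow> complex" where
  "weight g = (let t = rep (N #> g); n = inv t \<otimes> g in l n / \<alpha> t n)"

definition action :: "'g \<Rightarrow> 'g set \<Rightarrow> complex" where
  "action g S = \<alpha> g (rep S) * weight (g \<otimes> rep S) / weight (rep S)"

lemma weight_eq:
  assumes "g \<in> carrier G"
  obtains t m where "t \<in> carrier G" "m \<in> N" "g = t \<otimes> m" "t = rep (N #> g)" "weight g = l m / \<alpha> t m"
proof -
  define t where "t = rep (N #> g)"
  have t: "t \<in> carrier G" "N #> g = N #> t"
    using rep[OF rcosetsI[OF subset assms]] by (auto simp: t_def)
  obtain m where m: "m \<in> N" "g = t \<otimes> m"
    using assms t(2,1) by (rule rcos_eqE)
  have "inv t \<otimes> g = m"
    unfolding m(2) using t(1) m(1) by (simp flip: m_assoc)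
  then have "weight g = l m / \<alpha> t m"
    by (simp add: weight_def Let_def flip: t_def)
  with t(1) m t_def show ?thesis
    by (rule that)
qed

lemma weight_nonzero:
  assumes "g \<in> carrier G"
  shows "weight g \<noteq> 0"
proof -
  obtain t m where "t \<in> carrier G" "m \<in> N" "weight g = l m / \<alpha> t m"
    using assms by (rule weight_eq)
  then show ?thesis
    by (simp add: l_nonzero alpha_nonzero N_mem)
qed

text \<open>In terms of the idempotent \<open>e\<close>, both sides express \<open>u_gn e\<close>
  through \<open>u_g u_n e\<close>, where \<open>u_n e = l(n) e\<close>. The computation is the
  cocycle identity for \<open>t\<close>, \<open>m\<close>, \<open>n\<close>, with
  \<open>g = t \<otimes> m\<close>.\<close>

lemma weight_mult:
  assumes g: "g \<in> carrier G" and n: "n \<in> N"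
  shows "weight (g \<otimes> n) = l n / \<alpha> g n * weight g"
proof -
  obtain t m where t: "t \<in> carrier G" "m \<in> N" "g = t \<otimes> m" "t = rep (N #> g)" "weight g = l m / \<alpha> t m"
    using g by (rule weight_eq)
  have "inv t \<otimes> (g \<otimes> n) = m \<otimes> n"
    unfolding t(3) using t(1,2) n by (simp flip: m_assoc)
  then have "weight (g \<otimes> n) = l (m \<otimes> n) / \<alpha> t (m \<otimes> n)"
    using g n by (simp add: weight_def Let_def rcos_mult_N flip: t(4))
  moreover have "\<alpha> t m * \<alpha> g n = \<alpha> t (m \<otimes> n) * \<alpha> m n"
    using alpha_assoc[of t m n] t(1-3) n by simp
  moreover have "\<alpha> m n \<noteq> 0"
    using t(2) n by (simp add: alpha_nonzero N_mem)
  moreover have "l n / \<alpha> g n * weight g = l m * l n / (\<alpha> t m * \<alpha> g n)"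
    by (simp add: t(5) mult.commute)
  ultimately show ?thesis
    using l_mult[OF t(2) n] by simp
qed

text \<open>The action does not depend on the representative: replacing \<open>t\<close> by
  \<open>t \<otimes> n\<close> changes the three factors by amounts that cancel, by the cocycle
  identity for \<open>g\<close>, \<open>t\<close>, \<open>n\<close>.\<close>

lemma action_rcos:
  assumes g: "g \<in> carrier G" and t: "t \<in> carrier G"
  shows "action g (N #> t) = \<alpha> g t * weight (g \<otimes> t) / weight t"
proof -
  have "rep (N #> t) \<in> carrier G" "N #> rep (N #> t) = N #> t"
    using rep[OF rcosetsI[OF subset t]] by auto
  then obtain n where n: "n \<in> N" "rep (N #> t) = t \<otimes> n"
    using t by (metis rcos_eqE)
  have "weight (g \<otimes> (t \<otimes> n)) = l n / \<alpha> (g \<otimes> t) n * weight (g \<otimes> t)"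
    using weight_mult[of "g \<otimes> t" n] g t n(1) by (simp add: m_assoc)
  then have "action g (N #> t) =
      \<alpha> g (t \<otimes> n) * (l n / \<alpha> (g \<otimes> t) n * weight (g \<otimes> t)) / (l n / \<alpha> t n * weight t)"
    using weight_mult[OF t n(1)] by (simp add: action_def n(2))
  moreover have "\<alpha> g t * \<alpha> (g \<otimes> t) n = \<alpha> g (t \<otimes> n) * \<alpha> t n"
    using alpha_assoc g t n(1) by simp
  moreover have "\<alpha> (g \<otimes> t) n \<noteq> 0" "\<alpha> t n \<noteq> 0" "l n \<noteq> 0" "weight t \<noteq> 0"
    using g t n(1) N_mem[OF n(1)] by (auto simp: alpha_nonzero l_nonzero weight_nonzero)
  ultimately have "action g (N #> t) = \<alpha> g t * \<alpha> (g \<otimes> t) n * weight (g \<otimes> t) / (\<alpha> (g \<otimes> t) n * weight t)"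
    by (simp add: field_simps)
  with \<open>\<alpha> (g \<otimes> t) n \<noteq> 0\<close> show ?thesis
    by simp
qed

text \<open>This is the module law for \<open>u_g u_h\<close>. If \<open>t\<close> represents
  \<open>S\<close>, then \<open>h \<otimes> t\<close> may be used for the translated coset; its
  weight cancels and the cocycle identity for \<open>g\<close>, \<open>h\<close>, \<open>t\<close>
  remains.\<close>

lemma action_mult:
  assumes g: "g \<in> carrier G" and h: "h \<in> carrier G" and S: "S \<in> rcosets N"
  shows "action g ((N #> h) <#> S) * action h S = \<alpha> g h * action (g \<otimes> h) S"
proof -
  obtain t where t: "t \<in> carrier G" "S = N #> t"
    using rep[OF S] by metis
  have "action g ((N #> h) <#> S) = \<alpha> g (h \<otimes> t) * weight (g \<otimes> h \<otimes> t) / weight (h \<otimes> t)"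
    using g h t by (simp add: rcos_sum action_rcos m_assoc)
  moreover have "\<alpha> g h * \<alpha> (g \<otimes> h) t = \<alpha> g (h \<otimes> t) * \<alpha> h t"
    using g h t by (simp add: alpha_assoc)
  moreover have "weight (h \<otimes> t) \<noteq> 0"
    using h t by (simp add: weight_nonzero)
  ultimately show ?thesis
    using g h t by (simp add: action_rcos)
qed

text \<open>The cocycle identity for 1, 1, \<open>t\<close> makes \<open>\<alpha> \<one> t\<close>
  independent of \<open>t\<close>.\<close>

lemma action_one:
  assumes "S \<in> rcosets N"
  shows "action \<one> S = \<alpha> \<one> \<one>"
proof -
  obtain t where t: "t \<in> carrier G" "S = N #> t"
    using rep[OF assms] by metis
  have "\<alpha> \<one> \<one> = \<alpha> \<one> t"
    using alpha_assoc[of \<one> \<one> t] alpha_nonzero[of \<one> t] t by simp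
  then show ?thesis
    using t by (simp add: action_rcos weight_nonzero)
qed

text \<open>The entry at \<open>(S, T)\<close> of the matrix of \<open>a\<close> on the induced
  module: \<open>u_g\<close> moves the basis vector of \<open>T\<close> to that of \<open>S\<close>
  exactly when the coset of \<open>g\<close> takes \<open>T\<close> to \<open>S\<close>.\<close>

definition repr_coeff :: "('g \<Rightarrow> complex) \<Rightarrow> 'g set \<Rightarrow> 'g set \<Rightarrow> complex" where
  "repr_coeff a S T = (\<Sum>g\<in>carrier G. if (N #> g) <#> T = S then a g * action g T else 0)"

lemma repr_coeff_add: "repr_coeff (a \<oplus>\<^bsub>A\<^esub> b) S T = repr_coeff a S T + repr_coeff b S T"
  unfolding repr_coeff_def sum.distrib[symmetric]
  by (intro sum.cong refl) (simp add: twisted_group_algebra_def distrib_right)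

lemma repr_coeff_smult: "repr_coeff (c \<odot>\<^bsub>A\<^esub> a) S T = c * repr_coeff a S T"
  unfolding repr_coeff_def sum_distrib_left
  by (intro sum.cong refl) (simp add: twisted_group_algebra_def mult.assoc)

lemma rcos_mult_closed:
  assumes "g \<in> carrier G" "T \<in> rcosets N"
  shows "(N #> g) <#> T \<in> rcosets N"
proof -
  have "(N #> g) <#> T = N #> (g \<otimes> rep T)"
    using rcos_sum[OF assms(1) rep(1)[OF assms(2)]] unfolding rep(2)[OF assms(2)] .
  then show ?thesis
    using rcosetsI[OF subset] assms(1) rep(1)[OF assms(2)] by simp
qed

lemma finite_rcosets: "finite (rcosets N)"
  using finite_G by (simp add: RCOSETS_def)

lemma repr_coeff_mult:
  assumes U: "U \<in> rcosets N"
  shows "(\<Sum>T\<in>rcosets N. repr_coeff a S T * repr_coeff b T U) = repr_coeff (a \<otimes>\<^bsub>A\<^esub> b) S U"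
proof -
  let ?K = "rcosets N" and ?G = "carrier G"
  have "(\<Sum>T\<in>?K. repr_coeff a S T * repr_coeff b T U)
      = (\<Sum>T\<in>?K. \<Sum>g\<in>?G. \<Sum>h\<in>?G. if (N #> h) <#> U = T then
          (if (N #> g) <#> T = S then a g * action g T else 0) * (b h * action h U) else 0)"
    unfolding repr_coeff_def sum_product by (intro sum.cong refl) simp
  also have "\<dots> = (\<Sum>g\<in>?G. \<Sum>h\<in>?G. \<Sum>T\<in>?K. if (N #> h) <#> U = T then
          (if (N #> g) <#> T = S then a g * action g T else 0) * (b h * action h U) else 0)"
    by (rule trans[OF sum.swap sum.cong[OF refl sum.swap]])
  also have "\<dots> = (\<Sum>g\<in>?G. \<Sum>h\<in>?G. if (N #> (g \<otimes> h)) <#> U = S then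
          a g * b h * \<alpha> g h * action (g \<otimes> h) U else 0)"
  \<comment> \<open>Only \<open>T = (N #> h) <#> U\<close> contributes, and there
    \<open>action_mult\<close> combines the two actions.\<close>
  proof (intro sum.cong refl)
    fix g h assume g: "g \<in> ?G" and h: "h \<in> ?G"
    obtain t where t: "t \<in> carrier G" "U = N #> t"
      using rep[OF U] by metis
    have "(N #> g) <#> ((N #> h) <#> U) = (N #> (g \<otimes> h)) <#> U"
      using g h t by (simp add: rcos_sum m_assoc)
    moreover have "action g ((N #> h) <#> U) * (b h * action h U) = b h * (\<alpha> g h * action (g \<otimes> h) U)"
      using action_mult[OF g h U] by (simp add: mult_ac)
    ultimately show "(\<Sum>T\<in>?K. if (N #> h) <#> U = T then
          (if (N #> g) <#> T = S then a g * action g T else 0) * (b h * action h U) else 0) =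
        (if (N #> (g \<otimes> h)) <#> U = S then a g * b h * \<alpha> g h * action (g \<otimes> h) U else 0)"
      using rcos_mult_closed[OF h U] by (simp add: finite_rcosets mult.assoc)
  qed
  \<comment> \<open>The extra index \<open>x\<close> stands for the product, so that swapping sums
    collects the pairs \<open>(g, h)\<close> contributing to the coefficient of the product at
    \<open>x\<close>.\<close>
  also have "\<dots> = (\<Sum>g\<in>?G. \<Sum>h\<in>?G. \<Sum>x\<in>?G. if x = g \<otimes> h then
          (if (N #> x) <#> U = S then a g * b h * \<alpha> g h * action x U else 0) else 0)"
    using finite_G by (intro sum.cong refl) simp
  also have "\<dots> = (\<Sum>x\<in>?G. \<Sum>g\<in>?G. \<Sum>h\<in>?G. if x = g \<otimes> h then
          (if (N #> x) <#> U = S then a g * b h * \<alpha> g h * action x U else 0) else 0)"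
    by (rule trans[OF sum.cong[OF refl sum.swap] sum.swap])
  also have "\<dots> = repr_coeff (a \<otimes>\<^bsub>A\<^esub> b) S U"
    unfolding repr_coeff_def
  proof (intro sum.cong refl)
    fix x
    have fin: "finite (?G \<times> ?G)"
      using finite_G by simp
    have "(a \<otimes>\<^bsub>A\<^esub> b) x = (\<Sum>p\<in>?G \<times> ?G. case p of (g, h) \<Rightarrow> if x = g \<otimes> h then a g * b h * \<alpha> g h else 0)"
      unfolding mult_apply by (rule sum.mono_neutral_cong_left[OF fin]) (auto split: if_splits)
    also have "\<dots> = (\<Sum>g\<in>?G. \<Sum>h\<in>?G. if x = g \<otimes> h then a g * b h * \<alpha> g h else 0)"
      by (simp add: sum.cartesian_product)
    finally have *: "(a \<otimes>\<^bsub>A\<^esub> b) x = (\<Sum>g\<in>?G. \<Sum>h\<in>?G. if x = g \<otimes> h then a g * b h * \<alpha> g h else 0)" .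
    show "(\<Sum>g\<in>?G. \<Sum>h\<in>?G. if x = g \<otimes> h then
          (if (N #> x) <#> U = S then a g * b h * \<alpha> g h * action x U else 0) else 0) =
        (if (N #> x) <#> U = S then (a \<otimes>\<^bsub>A\<^esub> b) x * action x U else 0)"
    proof (cases "(N #> x) <#> U = S")
      case True
      show ?thesis
        unfolding * if_P[OF True] sum_distrib_right by (intro sum.cong refl) simp
    next
      case False
      show ?thesis
        unfolding * if_not_P[OF False] if_cancel by simp
    qed
  qed
  finally show ?thesis .
qed

lemma repr_coeff_one:
  assumes T: "T \<in> rcosets N"
  shows "repr_coeff \<one>\<^bsub>A\<^esub> S T = (if S = T then 1 else 0)"
proof -
  have "repr_coeff \<one>\<^bsub>A\<^esub> S T
      = (\<Sum>g\<in>carrier G. if g = \<one> then (if N <#> T = S then inverse (\<alpha> \<one> \<one>) * action \<one> T else 0) else 0)"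
    unfolding repr_coeff_def
    by (intro sum.cong) (auto simp: twisted_group_algebra_def coset_mult_one subset)
  also have "\<dots> = (if S = T then 1 else 0)"
    using T by (auto simp: finite_G action_one rcosets_mult_eq alpha_nonzero)
  finally show ?thesis .
qed

text \<open>A nonzero entry comes from some \<open>g\<close> in \<open>R\<close> whose coset takes
  \<open>T\<close> to \<open>S\<close>; solving for that coset gives the elementary degree of the
  position \<open>(S, T)\<close>.\<close>

lemma repr_coeff_hcomp:
  assumes a: "a \<in> hcomp Q R" and R: "R \<in> rcosets N" and S: "S \<in> rcosets N" and T: "T \<in> rcosets N"
    and nz: "repr_coeff a S T \<noteq> 0"
  shows "S <#> inv\<^bsub>G Mod N\<^esub> T = R"
proof -
  obtain g where g: "g \<in> carrier G" "(N #> g) <#> T = S" "a g \<noteq> 0"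
    using nz unfolding repr_coeff_def
    by (auto elim!: sum.not_neutral_contains_not_neutral split: if_splits)
  have "R \<subseteq> carrier G"
    using R rcosets_carrier by blast
  then have "g \<in> R"
    using a g by (auto simp: hcomp_quotient)
  then have "N #> g = R"
    using rcosets_eq[OF R] g(1) by blast
  moreover have "carrier (G Mod N) = rcosets N"
    by (simp add: FactGroup_def)
  ultimately show ?thesis
    using g(2) R S T group.inv_solve_right[OF factorgroup_is_group, of R S T] by simp
qed

lemma crossed_product_of_lagrangian:
  assumes simple: "simple_algebra A" and card: "(card N)\<^sup>2 = Coset.order G"
  shows "elementary_crossed_product_class Q"
proof -
  obtain gs where gs: "set gs = rcosets N" "distinct gs"
    using finite_distinct_list[OF finite_rcosets] by blast
  define r where "r = length gs"
  define B where "B = module_mat TYPE(complex) r r"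
  have gs_mem: "gs ! i \<in> rcosets N" if "i < r" for i
    using nth_mem[of i gs] that unfolding r_def gs(1) by simp
  \<comment> \<open>By Lagrange's theorem \<open>r * card N\<close> is the square of
    \<open>card N\<close>; cancel the positive factor.\<close>
  have r: "r = card N" "r > 0"
  proof -
    have "card (rcosets N) * card N = (card N)\<^sup>2"
      using lagrange_finite[OF finite_G is_subgroup] card by simp
    moreover have "card N > 0"
      using finite_subset[OF subset finite_G] subgroup.one_closed[OF is_subgroup]
      by (metis card_gt_0_iff empty_iff)
    ultimately show "r = card N"
      using distinct_card[OF gs(2)] gs(1) by (simp add: r_def power2_eq_square)
    then show "r > 0"
      using \<open>card N > 0\<close> by simp
  qed
  define \<psi> where "\<psi> a = Matrix.mat r r (\<lambda>(i, j). repr_coeff a (gs ! i) (gs ! j))" for a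
  have A: "ring A"
    using complex_algebra by (simp add: complex_algebra_def)
  have B: "ring B"
    using complex_algebra_mat by (simp add: complex_algebra_def B_def)
  have \<psi>_index: "\<psi> a $$ (i, j) = repr_coeff a (gs ! i) (gs ! j)" if "i < r" "j < r" for a i j
    using that by (simp add: \<psi>_def)
  have \<psi>_closed: "\<psi> a \<in> carrier_mat r r" for a
    by (simp add: \<psi>_def)
  have \<psi>_add: "\<psi> (a \<oplus>\<^bsub>A\<^esub> b) = \<psi> a \<oplus>\<^bsub>B\<^esub> \<psi> b" for a b
    by (rule eq_matI) (simp_all add: \<psi>_def B_def module_mat_simps repr_coeff_add)
  have \<psi>_smult: "\<psi> (c \<odot>\<^bsub>A\<^esub> a) = c \<odot>\<^bsub>B\<^esub> \<psi> a" for c a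
    by (rule eq_matI) (simp_all add: \<psi>_def B_def module_mat_simps repr_coeff_smult)
  have \<psi>_mult: "\<psi> (a \<otimes>\<^bsub>A\<^esub> b) = \<psi> a \<otimes>\<^bsub>B\<^esub> \<psi> b" for a b
  proof (rule eq_matI)
    fix i j assume "i < dim_row (\<psi> a \<otimes>\<^bsub>B\<^esub> \<psi> b)" "j < dim_col (\<psi> a \<otimes>\<^bsub>B\<^esub> \<psi> b)"
    then have ij: "i < r" "j < r"
      by (simp_all add: B_def module_mat_simps \<psi>_def)
    have bij: "bij_betw ((!) gs) {..<r} (rcosets N)"
      using bij_betw_nth[OF gs(2)] gs(1) by (simp add: r_def)
    have "(\<psi> a * \<psi> b) $$ (i, j)
        = (\<Sum>k<r. repr_coeff a (gs ! i) (gs ! k) * repr_coeff b (gs ! k) (gs ! j))"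
      using ij by (auto simp: \<psi>_def scalar_prod_def atLeast0LessThan intro!: sum.cong)
    also have "\<dots> = (\<Sum>T\<in>rcosets N. repr_coeff a (gs ! i) T * repr_coeff b T (gs ! j))"
      by (rule sum.reindex_bij_betw[OF bij])
    also have "\<dots> = \<psi> (a \<otimes>\<^bsub>A\<^esub> b) $$ (i, j)"
      using ij by (simp add: repr_coeff_mult gs_mem \<psi>_index)
    finally show "\<psi> (a \<otimes>\<^bsub>A\<^esub> b) $$ (i, j) = (\<psi> a \<otimes>\<^bsub>B\<^esub> \<psi> b) $$ (i, j)"
      by (simp add: B_def module_mat_simps)
  qed (simp_all add: B_def module_mat_simps \<psi>_def)
  have \<psi>_one: "\<psi> \<one>\<^bsub>A\<^esub> = \<one>\<^bsub>B\<^esub>"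
  proof (rule eq_matI)
    fix i j assume "i < dim_row \<one>\<^bsub>B\<^esub>" "j < dim_col \<one>\<^bsub>B\<^esub>"
    then have ij: "i < r" "j < r"
      by (simp_all add: B_def module_mat_simps)
    then have "gs ! i = gs ! j \<longleftrightarrow> i = j"
      using nth_eq_iff_index_eq[OF gs(2)] by (simp add: r_def)
    with ij show "\<psi> \<one>\<^bsub>A\<^esub> $$ (i, j) = \<one>\<^bsub>B\<^esub> $$ (i, j)"
      by (simp add: \<psi>_index repr_coeff_one gs_mem B_def module_mat_simps)
  qed (simp_all add: \<psi>_def B_def module_mat_simps)
  have \<psi>_hom: "\<psi> \<in> Ring.ring_hom A B"
    by (rule ring_hom_memI) (simp_all add: \<psi>_add \<psi>_mult \<psi>_one \<psi>_closed B_def module_mat_simps(5))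
  interpret \<psi>: ring_hom_ring A B \<psi>
    by (rule ring_hom_ringI2[OF A B \<psi>_hom])
  \<comment> \<open>The identity goes to the identity matrix, which is nonzero as
    \<open>r > 0\<close>. Simplicity then leaves only the zero ideal as kernel.\<close>
  have "a_kernel A B \<psi> \<noteq> carrier A"
  proof
    assume "a_kernel A B \<psi> = carrier A"
    then have "\<psi> \<one>\<^bsub>A\<^esub> = \<zero>\<^bsub>B\<^esub>"
      using \<psi>.R.one_closed unfolding a_kernel_def' by blast
    then have "(1\<^sub>m r :: complex mat) $$ (0, 0) = 0\<^sub>m r r $$ (0, 0)"
      by (simp add: \<psi>_one B_def module_mat_simps)
    then show False
      using r(2) by simp
  qed
  then have "a_kernel A B \<psi> = {\<zero>\<^bsub>A\<^esub>}"
    using simple \<psi>.kernel_is_ideal by (auto simp: simple_algebra_def)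
  then have inj: "inj_on \<psi> (carrier A)"
    by (rule \<psi>.trivial_ker_imp_inj)
  interpret H: coordinates_hom A "carrier G" "\<lambda>g f. f g" B "{..<r} \<times> {..<r}" "\<lambda>p M. M $$ p" \<psi>
  proof (intro coordinates_hom.intro coordinates_hom_axioms.intro coordinates_A inj \<psi>_add \<psi>_smult)
    show "coordinates B ({..<r} \<times> {..<r}) (\<lambda>p M. M $$ p)"
      unfolding B_def by (rule coordinates_mat)
    show "\<psi> a \<in> carrier B" for a
      using \<psi>_closed by (simp add: B_def module_mat_simps(5))
  qed
  \<comment> \<open>Both dimensions equal the square of \<open>card N\<close>, so injectivity gives
    surjectivity.\<close>
  have "card (carrier G) = card ({..<r} \<times> {..<r})"
    using card r(1) by (simp add: card_cartesian_product Coset.order_def power2_eq_square)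
  then have "bij_betw \<psi> (carrier A) (carrier B)"
    by (rule H.bij_betw_of_card_eq)
  then have iso: "\<psi> \<in> algebra_iso A B"
    using \<psi>_hom \<psi>_smult by (simp add: algebra_iso_def ring_iso_def)
  have "\<psi> ` hcomp Q R \<subseteq> hcomp (elementary_grading (G Mod N) gs) R" if "R \<in> rcosets N" for R
  proof (rule image_subsetI)
    fix a assume "a \<in> hcomp Q R"
    then have "gs ! i <#> inv\<^bsub>G Mod N\<^esub> (gs ! j) = R" if "i < r" "j < r" "\<psi> a $$ (i, j) \<noteq> 0" for i j
      using that \<open>R \<in> rcosets N\<close> repr_coeff_hcomp[of a R "gs ! i" "gs ! j"] by (simp add: \<psi>_index gs_mem)
    then show "\<psi> a \<in> hcomp (elementary_grading (G Mod N) gs) R"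
      using \<psi>_closed by (simp add: elementary_grading_def Let_def flip: r_def)
  qed
  then have graded: "\<forall>R\<in>carrier (G Mod N). \<psi> ` hcomp Q R \<subseteq> hcomp (elementary_grading (G Mod N) gs) R"
    by (simp add: FactGroup_def)
  \<comment> \<open>The matrices are graded by \<open>G Mod N\<close> itself, so the group
    isomorphism is the identity.\<close>
  have id: "(\<lambda>R. R) \<in> iso (G Mod N) (G Mod N)"
    by (simp add: iso_def hom_def bij_betw_def)
  have sel: "alg Q = A" "grading_group Q = G Mod N"
      "alg (elementary_grading (G Mod N) gs) = B" "grading_group (elementary_grading (G Mod N) gs) = G Mod N"
    by (simp_all add: elementary_grading_def quotient_grading_def twisted_grading_def Let_def B_def r_def)
  have "is_grading (elementary_grading (G Mod N) gs)"
    by (rule is_grading_elementary[OF factorgroup_is_group]) (simp add: gs(1) FactGroup_def)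
  then have "graded_equivalent Q (elementary_grading (G Mod N) gs)"
    unfolding graded_equivalent_def sel using is_grading_quotient graded id iso
    by (intro conjI bexI[of _ \<psi>] bexI[of _ "\<lambda>R. R"])
  then show ?thesis
    unfolding elementary_crossed_product_class_def
    using factorgroup_is_group gs by (intro exI[of _ "G Mod N"] exI[of _ gs]) (simp add: FactGroup_def)
qed

end

theorem theoremC:
  fixes G :: "'g monoid" and \<alpha> :: "'g \<Rightarrow> 'g \<Rightarrow> complex" and N :: "'g set"
  assumes "group G" and "finite (carrier G)"
    and "two_cocycle G \<alpha>" and "nondegenerate G \<alpha>"
    and "N \<lhd> G"
  shows "elementary_crossed_product_class (quotient_grading (twisted_grading G \<alpha>) N) \<longleftrightarrow>
         lagrangian G \<alpha> N \<and> comm_group (G\<lparr>carrier := N\<rparr>)"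
proof -
  have simple: "simple_algebra (twisted_group_algebra G \<alpha>)"
    using assms(4) by (simp add: nondegenerate_def)
  interpret twisted_group_normal G \<alpha> N
    using assms simple by (simp add: twisted_group_normal_def twisted_group_def
        twisted_group_axioms_def simple_algebra_def)
  show ?thesis
  proof
    assume "elementary_crossed_product_class (quotient_grading (twisted_grading G \<alpha>) N)"
    then show "lagrangian G \<alpha> N \<and> comm_group (G\<lparr>carrier := N\<rparr>)"
      using lagrangian_of_crossed_product is_subgroup assms(4)
      by (simp add: lagrangian_def isotropic_def)
  next
    assume "lagrangian G \<alpha> N \<and> comm_group (G\<lparr>carrier := N\<rparr>)"
    then have "cohomologous (G\<lparr>carrier := N\<rparr>) \<alpha> (\<lambda>_ _. 1)" and card: "(card N)\<^sup>2 = Coset.order G"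
      by (simp_all add: lagrangian_def isotropic_def)
    then obtain l where l: "\<And>n. n \<in> N \<Longrightarrow> l n \<noteq> 0"
        "\<And>n m. n \<in> N \<Longrightarrow> m \<in> N \<Longrightarrow> \<alpha> n m = l n * l m / l (n \<otimes>\<^bsub>G\<^esub> m)"
      by (auto simp: cohomologous_def)
    \<comment> \<open>The cochain trivialising \<alpha> on \<open>N\<close> supplies the
      one-dimensional module to be induced.\<close>
    interpret isotropic_normal G \<alpha> N l
      by unfold_locales (auto simp: l)
    show "elementary_crossed_product_class (quotient_grading (twisted_grading G \<alpha>) N)"
      using simple card by (rule crossed_product_of_lagrangian)
  qed
qed

end
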